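(* Let $X,Y$ be metrizable spaces and $k_1,k_2,k,n_1,n_2,n,m$ be non-negative integers or infinity. (1) (First Multiplication Formula) If $X$ has the $m$-$\overline{\mathrm{DD}}{}^{\{n,k_1\}}$-property and $Y$ has the $m$-$\overline{\mathrm{DD}}{}^{\{n,k_2\}}$-property, then the product $X\times Y$ has the $m$-$\overline{\mathrm{DD}}{}^{\{n,k_1+k_2+1\}}$-property. (2) (Second Multiplication Formula) If $n=n_1+n_2+1$, $k=k_1+k_2+1$, $X$ has the $m$-$\overline{\mathrm{DD}}{}^{\{n_1,k_1\}}$-property and $Y$ has both the $m$-$\overline{\mathrm{DD}}{}^{\{n,k_2\}}$-property and the $m$-$\overline{\mathrm{DD}}{}^{\{n_2,k\}}$-property, then $X\times Y$ has the $m$-$\overline{\mathrm{DD}}{}^{\{n,k\}}$-property. (3) (Multiplication by a cell) If $X$ has the $m$-$\overline{\mathrm{DD}}{}^{\{n,k\}}$-property, then for any (finite) $d<m+1$ the product $\mathbb I^d\times X$ has the $(m-d)$-$\overline{\mathrm{DD}}{}^{\{d+n,d+k\}}$-property.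
   Context: All maps are continuous. $\infty+\infty=\infty+n=n+\infty=\infty-n=\infty$ for finite $n$. $\mathbb I=[0,1]$ and $\mathbb I^\infty$ is the Hilbert cube. Two maps $f,g:K\to X$ are $\mathcal U$-homotopic, for a cover $\mathcal U$ of $X$, if there is a homotopy $h:K\times[0,1]\to X$ from $f$ to $g$ such that for each $x\in K$ the set $h(\{x\}\times[0,1])$ lies in some $U\in\mathcal U$. For $m,n,k$ non-negative integers or $\infty$, a space $X$ has the $m$-$\overline{\mathrm{DD}}{}^{\{n,k\}}$-property if for any open cover $\mathcal U$ of $X$ and any maps $f:\mathbb I^m\times\mathbb I^n\to X$, $g:\mathbb I^m\times\mathbb I^k\to X$ there are maps $f':\mathbb I^m\times\mathbb I^n\to X$, $g':\mathbb I^m\times\mathbb I^k\to X$ such that $f'$ is $\mathcal U$-homotopic to $f$, $g'$ is $\mathcal U$-homotopic to $g$, and $f'(\{z\}\times\mathbb I^n)\cap g'(\{z\}\times\mathbb I^k)=\varnothing$ for all $z\in\mathbb I^m$. *)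

theory Defs
  imports "HOL-Analysis.Analysis"
begin

text \<open>Dimensions range over \<^typ>\<open>enat\<close>, whose arithmetic satisfies
  $\infty + \infty = \infty + n = n + \infty = \infty - n = \infty$ for finite $n$.
  The cube below is a singleton for dimension \<open>0\<close> and the Hilbert cube for
  dimension \<open>\<infinity>\<close>, where the index set is all of \<^typ>\<open>nat\<close>.\<close>

definition cube :: "enat \<Rightarrow> (nat \<Rightarrow> real) topology" where
  "cube n = product_topology (\<lambda>_. top_of_set {0..1}) {i. enat i < n}"

definition open_cover :: "'a topology \<Rightarrow> 'a set set \<Rightarrow> bool" where
  "open_cover X \<U> \<longleftrightarrow> (\<forall>U\<in>\<U>. openin X U) \<and> \<Union>\<U> = topspace X"

definition cover_homotopic ::
    "'k topology \<Rightarrow> 'a topology \<Rightarrow> 'a set set \<Rightarrow> ('k \<Rightarrow> 'a) \<Rightarrow> ('k \<Rightarrow> 'a) \<Rightarrow> bool" where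
  "cover_homotopic K X \<U> f g \<longleftrightarrow>
     (\<exists>h. continuous_map (prod_topology K (top_of_set {0..1::real})) X h \<and>
          (\<forall>x\<in>topspace K. h (x, 0) = f x \<and> h (x, 1) = g x) \<and>
          (\<forall>x\<in>topspace K. \<exists>U\<in>\<U>. h ` ({x} \<times> {0..1}) \<subseteq> U))"

definition fiberwise_DD :: "enat \<Rightarrow> enat \<Rightarrow> enat \<Rightarrow> 'a topology \<Rightarrow> bool" where
  "fiberwise_DD m n k X \<longleftrightarrow>
     (\<forall>\<U> f g. open_cover X \<U> \<and>
        continuous_map (prod_topology (cube m) (cube n)) X f \<and>
        continuous_map (prod_topology (cube m) (cube k)) X g \<longrightarrow>
        (\<exists>f' g'. continuous_map (prod_topology (cube m) (cube n)) X f' \<and>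
           continuous_map (prod_topology (cube m) (cube k)) X g' \<and>
           cover_homotopic (prod_topology (cube m) (cube n)) X \<U> f' f \<and>
           cover_homotopic (prod_topology (cube m) (cube k)) X \<U> g' g \<and>
           (\<forall>z\<in>topspace (cube m).
              f' ` ({z} \<times> topspace (cube n)) \<inter> g' ` ({z} \<times> topspace (cube k)) = {})))"

end

theory Submission
  imports Defs
begin

text \<open>Fix metrics and call a relation between points of two compact spaces avoidable in \<open>X\<close> if
  arbitrary maps into \<open>X\<close> can be changed by arbitrarily small homotopies so that related points have
  distinct images; the fiberwise property says that lying over the same point of the cube of
  dimension \<open>m\<close> is avoidable. Finite unions of closed avoidable relations are avoidable, and
  homotopies can be extended with control from subcubes and slabs of cubes.

  For the multiplication formulas with finite dimensions take piecewise linear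
  self-maps \<open>r1\<close>, \<open>r2\<close> of the interval, close to the identity, such that for each \<open>s\<close> one of
  \<open>r1 s\<close>, \<open>r2 s\<close> lies in a finite grid. Applied coordinatewise to a cube of dimension \<open>a + b + 1\<close>,
  either \<open>r1\<close> sends the point into the \<open>a\<close>-dimensional skeleton of the grid or \<open>r2\<close> sends it into the
  \<open>b\<close>-dimensional one. Separate the first coordinates over one family of skeleta and the second
  coordinates over the other, and precompose with \<open>r1\<close> and \<open>r2\<close>. If some dimension is infinite, the
  formulas reduce to simpler ones.

  For the product with the interval, perturb the interval-valued components to zigzags strictly monotone in one
  distinguished variable on each slab. On a slab that component may replace the variable as a coordinate and be
  regarded as one more parameter, so the hypothesis on \<open>X\<close> applies to every pair of slabs.\<close>

subsection \<open>Small homotopies\<close>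

text \<open>Metrics replace covers because errors then add along concatenated homotopies;
  compactness of the cubes makes both kinds of control equivalent. The obstacle to the
  multiplication formulas is dimension: the hypotheses speak of cubes smaller than the given ones.
  Pinning b + 1 of a + b + 1 coordinates to finitely many values leaves cubes of dimension a, where
  one factor can separate; a pigeonhole count supplies a + 1 pinned coordinates for the other factor
  whenever this fails. The number of pieces must be finite, whereas a Hilbert cube has infinitely
  many coordinates to pin; but an infinite sum of dimensions already equals one of its summands. The
  obstacle to the interval factor is that each map has one variable too many and one parameter too
  few. Points over the same parameter collide only if their interval components agree, so this
  common value can serve as the missing parameter, provided that it determines the surplus variable.
  Strict monotonicity on slabs ensures exactly this. Higher cells come from repeating the step, each
  product with a cell being the next space.\<close>

abbreviation unit_interval :: "real topology" where
  "unit_interval \<equiv> top_of_set {0..1}"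

lemma continuous_map_compose2:
  "continuous_map Y Z g \<Longrightarrow> continuous_map X Y f \<Longrightarrow> continuous_map X Z (\<lambda>x. g (f x))"
  using continuous_map_compose[of X Y f Z g] by (simp add: o_def)

lemma continuous_map_unit_interval:
  "continuous_map X unit_interval f \<longleftrightarrow>
    continuous_map X euclideanreal f \<and> (\<forall>x\<in>topspace X. 0 \<le> f x \<and> f x \<le> 1)"
  by (auto simp: continuous_map_in_subtopology Pi_iff)

lemma continuous_map_in_topspace:
  "continuous_map X Y f \<Longrightarrow> x \<in> topspace X \<Longrightarrow> f x \<in> topspace Y"
  using continuous_map_image_subset_topspace by fastforce

lemma compact_positive_lower_bound:
  fixes \<phi> :: "'a \<Rightarrow> real"
  assumes "compact_space K" "closedin K C" "continuous_map K euclideanreal \<phi>"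
    and "\<And>x. x \<in> C \<Longrightarrow> 0 < \<phi> x"
  obtains \<eta> where "0 < \<eta>" "\<And>x. x \<in> C \<Longrightarrow> \<eta> \<le> \<phi> x"
proof (cases "C = {}")
  case True
  then show ?thesis using that[of 1] by auto
next
  case False
  have "compactin K C"
    using assms closedin_compact_space by blast
  then have "compact (\<phi> ` C)"
    using assms(3) image_compactin compactin_euclidean_iff by blast
  then obtain s where "s \<in> \<phi> ` C" "\<And>t. t \<in> \<phi> ` C \<Longrightarrow> s \<le> t"
    using compact_attains_inf[of "\<phi> ` C"] False by auto
  then show ?thesis
    using that[of s] assms(4) by auto
qed

text \<open>The set where \<phi> is at least \<epsilon> is closed and misses time 0, so compactness
  keeps its times away from 0. This serves to slow deformations down until they move the values of a
  given map only slightly.\<close>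

lemma compact_uniformly_small:
  fixes \<phi> :: "'a \<times> real \<Rightarrow> real"
  assumes K: "compact_space K"
    and \<phi>: "continuous_map (prod_topology K unit_interval) euclideanreal \<phi>"
    and small: "\<And>x. x \<in> topspace K \<Longrightarrow> \<phi> (x, 0) < \<epsilon>"
  obtains c where "0 < c" "c \<le> 1" "\<And>x s. x \<in> topspace K \<Longrightarrow> 0 \<le> s \<Longrightarrow> s \<le> c \<Longrightarrow> \<phi> (x, s) < \<epsilon>"
proof -
  let ?P = "prod_topology K unit_interval"
  define C where "C = {z \<in> topspace ?P. \<phi> z \<in> {\<epsilon>..}}"
  have "compact_space ?P"
    using K by (simp add: compact_space_prod_topology compact_space_subtopology)
  moreover have "closedin ?P C"
    unfolding C_def using \<phi> by (intro closedin_continuous_map_preimage) auto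
  moreover have "continuous_map ?P euclideanreal snd"
    using continuous_map_snd[of K unit_interval] continuous_map_in_subtopology by blast
  moreover have "0 < snd z" if "z \<in> C" for z
  proof (cases z)
    case (Pair x s)
    then show ?thesis using that small[of x] by (cases "s = 0") (auto simp: C_def)
  qed
  ultimately obtain \<eta> where \<eta>: "0 < \<eta>" "\<And>z. z \<in> C \<Longrightarrow> \<eta> \<le> snd z"
    using compact_positive_lower_bound by metis
  show ?thesis
  proof (rule that[of "min 1 (\<eta> / 2)"])
    fix x s assume x: "x \<in> topspace K" and s: "0 \<le> s" "s \<le> min 1 (\<eta> / 2)"
    then have "(x, s) \<notin> C" using \<eta>(1) \<eta>(2)[of "(x, s)"] by auto
    then show "\<phi> (x, s) < \<epsilon>" using x s by (auto simp: C_def)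
  qed (use \<eta> in auto)
qed

lemma mdist_self: "x \<in> mspace m \<Longrightarrow> mdist m x x = 0"
  by simp

text \<open>Distance is measured from the starting map and not as the diameter of a track, so that
  bounds add under concatenation. The notion is directed: reversing a homotopy may double its
  bound.\<close>

definition small_homotopic ::
    "'k topology \<Rightarrow> 'a metric \<Rightarrow> real \<Rightarrow> ('k \<Rightarrow> 'a) \<Rightarrow> ('k \<Rightarrow> 'a) \<Rightarrow> bool" where
  "small_homotopic K m \<epsilon> f g \<longleftrightarrow>
     (\<exists>h. continuous_map (prod_topology K unit_interval) (mtopology_of m) h \<and>
          (\<forall>x\<in>topspace K. h (x, 0) = f x \<and> h (x, 1) = g x \<and>
             (\<forall>t\<in>{0..1}. mdist m (f x) (h (x, t)) < \<epsilon>)))"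

lemma small_homotopic_refl:
  assumes "continuous_map K (mtopology_of m) f" "0 < \<epsilon>"
  shows "small_homotopic K m \<epsilon> f f"
  unfolding small_homotopic_def
proof (intro exI conjI)
  show "continuous_map (prod_topology K unit_interval) (mtopology_of m) (\<lambda>z. f (fst z))"
    by (rule continuous_map_compose2[OF assms(1) continuous_map_fst])
  show "\<forall>x\<in>topspace K. f (fst (x, 0::real)) = f x \<and> f (fst (x, 1::real)) = f x \<and>
          (\<forall>t\<in>{0..1}. mdist m (f x) (f (fst (x, t::real))) < \<epsilon>)"
    using continuous_map_in_topspace[OF assms(1)] assms(2) by (auto simp: mdist_self)
qed

lemma small_homotopic_continuous:
  assumes "small_homotopic K m \<epsilon> f g"
  shows "continuous_map K (mtopology_of m) f" "continuous_map K (mtopology_of m) g"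
proof -
  obtain h where h: "continuous_map (prod_topology K unit_interval) (mtopology_of m) h"
     "\<And>x. x\<in>topspace K \<Longrightarrow> h (x, 0) = f x \<and> h (x, 1) = g x"
    using assms unfolding small_homotopic_def by blast
  have "continuous_map K (mtopology_of m) (\<lambda>x. h (x, 0))" "continuous_map K (mtopology_of m) (\<lambda>x. h (x, 1))"
    by (auto intro!: continuous_map_compose2[OF h(1)] simp: continuous_map_paired)
  then show "continuous_map K (mtopology_of m) f" "continuous_map K (mtopology_of m) g"
    using h(2) continuous_map_eq[of K "mtopology_of m" "\<lambda>x. h (x, 0)" f]
      continuous_map_eq[of K "mtopology_of m" "\<lambda>x. h (x, 1)" g] by auto
qed

lemma small_homotopic_dist:
  assumes "small_homotopic K m \<epsilon> f g" "x \<in> topspace K"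
  shows "mdist m (f x) (g x) < \<epsilon>"
  using assms unfolding small_homotopic_def by (metis atLeastAtMost_iff order_refl zero_le_one)

lemma small_homotopic_mono:
  "small_homotopic K m \<epsilon> f g \<Longrightarrow> \<epsilon> \<le> \<delta> \<Longrightarrow> small_homotopic K m \<delta> f g"
  unfolding small_homotopic_def by (meson less_le_trans)

lemma small_homotopic_trans:
  assumes "small_homotopic K m a f g" "small_homotopic K m b g k"
  shows "small_homotopic K m (a + b) f k"
proof -
  let ?P = "prod_topology K unit_interval"
  obtain h1 where h1: "continuous_map ?P (mtopology_of m) h1"
    and h1': "\<And>x. x \<in> topspace K \<Longrightarrow> h1 (x, 0) = f x" "\<And>x. x \<in> topspace K \<Longrightarrow> h1 (x, 1) = g x"
      "\<And>x t. x \<in> topspace K \<Longrightarrow> 0 \<le> t \<Longrightarrow> t \<le> 1 \<Longrightarrow> mdist m (f x) (h1 (x, t)) < a"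
    using assms(1) unfolding small_homotopic_def by auto
  obtain h2 where h2: "continuous_map ?P (mtopology_of m) h2"
    and h2': "\<And>x. x \<in> topspace K \<Longrightarrow> h2 (x, 0) = g x" "\<And>x. x \<in> topspace K \<Longrightarrow> h2 (x, 1) = k x"
      "\<And>x t. x \<in> topspace K \<Longrightarrow> 0 \<le> t \<Longrightarrow> t \<le> 1 \<Longrightarrow> mdist m (g x) (h2 (x, t)) < b"
    using assms(2) unfolding small_homotopic_def by auto
  \<comment> \<open>Both halves run at double speed. The clamps \<open>min 1\<close> and
    \<open>max 0\<close> are inactive on their own half and keep the time in the interval on the
    other, so each branch is continuous on the whole cylinder.\<close>
  define h where "h = (\<lambda>z. if 2 * snd z \<le> 1 then h1 (fst z, min 1 (2 * snd z)) else h2 (fst z, max 0 (2 * snd z - 1)))"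
  have snd: "continuous_map ?P euclideanreal snd"
    using continuous_map_snd[of K unit_interval] continuous_map_in_subtopology by blast
  have "continuous_map ?P (mtopology_of m) h"
    unfolding h_def
  proof (rule continuous_map_cases_le)
    show "continuous_map (subtopology ?P {x \<in> topspace ?P. 2 * snd x \<le> 1}) (mtopology_of m)
            (\<lambda>x. h1 (fst x, min 1 (2 * snd x)))"
      by (rule continuous_map_from_subtopology, rule continuous_map_compose2[OF h1])
        (auto simp: continuous_map_paired continuous_map_unit_interval continuous_map_fst intro!: continuous_intros snd)
    show "continuous_map (subtopology ?P {x \<in> topspace ?P. 1 \<le> 2 * snd x}) (mtopology_of m)
            (\<lambda>x. h2 (fst x, max 0 (2 * snd x - 1)))"
      by (rule continuous_map_from_subtopology, rule continuous_map_compose2[OF h2])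
        (auto simp: continuous_map_paired continuous_map_unit_interval continuous_map_fst intro!: continuous_intros snd)
    show "continuous_map ?P euclideanreal (\<lambda>x. 2 * snd x)"
      by (intro continuous_intros snd)
  qed (auto simp: h1' h2')
  moreover have "mdist m (f x) (h (x, t)) < a + b" if "x \<in> topspace K" "0 \<le> t" "t \<le> 1" for x t
  proof -
    have S: "f x \<in> mspace m" "g x \<in> mspace m" 
      using small_homotopic_continuous[OF assms(1), THEN continuous_map_in_topspace, OF that(1)] by auto
    have S': "mdist m (f x) (g x) < a" "0 < b"
      using small_homotopic_dist[OF assms(1) that(1)] small_homotopic_dist[OF assms(2) that(1)] 
        mdist_nonneg[of m "g x" "k x"] by linarith+
    have "h2 (x, max 0 (2 * t - 1)) \<in> mspace m"
      using continuous_map_in_topspace[OF h2, of "(x, max 0 (2 * t - 1))"] that by auto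
    then have "mdist m (f x) (h2 (x, max 0 (2 * t - 1))) \<le> mdist m (f x) (g x) + mdist m (g x) (h2 (x, max 0 (2 * t - 1)))"
      using S by (intro mdist_triangle)
    moreover have "mdist m (g x) (h2 (x, max 0 (2 * t - 1))) < b"
      by (rule h2'(3)[OF that(1)]) (use that in auto)
    ultimately have "mdist m (f x) (h2 (x, max 0 (2 * t - 1))) < a + b"
      using S' by linarith
    moreover have "mdist m (f x) (h1 (x, min 1 (2 * t))) < a"
      by (rule h1'(3)[OF that(1)]) (use that in auto)
    ultimately show ?thesis
      using S' unfolding h_def by (cases "2 * t \<le> 1") simp_all
  qed
  moreover have "h (x, 0) = f x \<and> h (x, 1) = k x" if "x \<in> topspace K" for x
    using that by (simp add: h_def h1' h2')
  ultimately show ?thesis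
    unfolding small_homotopic_def by (intro exI[of _ h]) auto
qed

lemma small_homotopic_compose:
  assumes "small_homotopic K m \<epsilon> f g" "continuous_map L K \<phi>"
  shows "small_homotopic L m \<epsilon> (\<lambda>x. f (\<phi> x)) (\<lambda>x. g (\<phi> x))"
proof -
  obtain h where h: "continuous_map (prod_topology K unit_interval) (mtopology_of m) h"
    and h': "\<And>x. x \<in> topspace K \<Longrightarrow> h (x, 0) = f x \<and> h (x, 1) = g x \<and> (\<forall>t\<in>{0..1}. mdist m (f x) (h (x, t)) < \<epsilon>)"
    using assms(1) unfolding small_homotopic_def by auto
  have "continuous_map (prod_topology L unit_interval) (mtopology_of m) (\<lambda>z. h (\<phi> (fst z), snd z))"
    by (rule continuous_map_compose2[OF h])
      (simp add: continuous_map_paired continuous_map_snd continuous_map_compose2[OF assms(2) continuous_map_fst])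
  then show ?thesis
    unfolding small_homotopic_def using h' continuous_map_in_topspace[OF assms(2)]
    by (intro exI[of _ "\<lambda>z. h (\<phi> (fst z), snd z)"]) simp
qed

text \<open>The product metric is at most the sum of the component distances, hence the factor
  2.\<close>

lemma small_homotopic_pair:
  assumes "small_homotopic K m1 \<epsilon> f1 g1" "small_homotopic K m2 \<epsilon> f2 g2"
  shows "small_homotopic K (prod_metric m1 m2) (2 * \<epsilon>) (\<lambda>x. (f1 x, f2 x)) (\<lambda>x. (g1 x, g2 x))"
proof -
  let ?P = "prod_topology K unit_interval"
  obtain h1 where h1: "continuous_map ?P (mtopology_of m1) h1"
    and h1': "\<And>x. x \<in> topspace K \<Longrightarrow> h1 (x, 0) = f1 x \<and> h1 (x, 1) = g1 x \<and> (\<forall>t\<in>{0..1}. mdist m1 (f1 x) (h1 (x, t)) < \<epsilon>)"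
    using assms(1) unfolding small_homotopic_def by auto
  obtain h2 where h2: "continuous_map ?P (mtopology_of m2) h2"
    and h2': "\<And>x. x \<in> topspace K \<Longrightarrow> h2 (x, 0) = f2 x \<and> h2 (x, 1) = g2 x \<and> (\<forall>t\<in>{0..1}. mdist m2 (f2 x) (h2 (x, t)) < \<epsilon>)"
    using assms(2) unfolding small_homotopic_def by auto
  have "mdist (prod_metric m1 m2) (f1 x, f2 x) (h1 (x, t), h2 (x, t)) < 2 * \<epsilon>"
    if "x \<in> topspace K" "t \<in> {0..1}" for x t
  proof -
    have "f1 x \<in> mspace m1" "h1 (x, t) \<in> mspace m1" "f2 x \<in> mspace m2" "h2 (x, t) \<in> mspace m2"
      using that continuous_map_in_topspace[OF h1] continuous_map_in_topspace[OF h2]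
        small_homotopic_continuous[OF assms(1), THEN continuous_map_in_topspace]
        small_homotopic_continuous[OF assms(2), THEN continuous_map_in_topspace] by auto
    then have "mdist (prod_metric m1 m2) (f1 x, f2 x) (h1 (x, t), h2 (x, t)) \<le>
        mdist m1 (f1 x) (h1 (x, t)) + mdist m2 (f2 x) (h2 (x, t))"
      by (simp add: Metric_space12.prod_metric_le_components[OF Metric_space12_mspace_mdist])
    moreover have "mdist m1 (f1 x) (h1 (x, t)) < \<epsilon>" "mdist m2 (f2 x) (h2 (x, t)) < \<epsilon>"
      using h1' h2' that by blast+
    ultimately show ?thesis by linarith
  qed
  then show ?thesis
    unfolding small_homotopic_def using h1 h2 h1' h2'
    by (intro exI[of _ "\<lambda>z. (h1 z, h2 z)"]) (auto simp: continuous_map_paired)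
qed

text \<open>With an arbitrary relation in place of equality of parameters, and arbitrary spaces in
  place of cubes, the same notion applies to skeleta, to slabs and to finite unions of such
  pieces.\<close>

definition avoidable ::
    "'k topology \<Rightarrow> 'l topology \<Rightarrow> 'a metric \<Rightarrow> ('k \<Rightarrow> 'l \<Rightarrow> bool) \<Rightarrow> bool" where
  "avoidable K L m R \<longleftrightarrow>
     (\<forall>\<epsilon>>0. \<forall>f g. continuous_map K (mtopology_of m) f \<and> continuous_map L (mtopology_of m) g \<longrightarrow>
        (\<exists>f' g'. small_homotopic K m \<epsilon> f f' \<and> small_homotopic L m \<epsilon> g g' \<and>
           (\<forall>x\<in>topspace K. \<forall>y\<in>topspace L. R x y \<longrightarrow> f' x \<noteq> g' y)))"

lemma avoidableE:
  assumes "avoidable K L m R" "0 < \<epsilon>" "continuous_map K (mtopology_of m) f" "continuous_map L (mtopology_of m) g"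
  obtains f' g' where "small_homotopic K m \<epsilon> f f'" "small_homotopic L m \<epsilon> g g'"
    "\<And>x y. x \<in> topspace K \<Longrightarrow> y \<in> topspace L \<Longrightarrow> R x y \<Longrightarrow> f' x \<noteq> g' y"
  using assms unfolding avoidable_def by metis

lemma avoidable_mono:
  assumes "avoidable K L m R" "\<And>x y. x \<in> topspace K \<Longrightarrow> y \<in> topspace L \<Longrightarrow> S x y \<Longrightarrow> R x y"
  shows "avoidable K L m S"
  unfolding avoidable_def
proof (intro allI impI)
  fix \<epsilon> :: real and f g
  assume "0 < \<epsilon>" "continuous_map K (mtopology_of m) f \<and> continuous_map L (mtopology_of m) g"
  then obtain f' g' where "small_homotopic K m \<epsilon> f f'" "small_homotopic L m \<epsilon> g g'"
    "\<And>x y. x \<in> topspace K \<Longrightarrow> y \<in> topspace L \<Longrightarrow> R x y \<Longrightarrow> f' x \<noteq> g' y"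
    using avoidableE[OF assms(1), of \<epsilon> f g] by blast
  then show "\<exists>f' g'. small_homotopic K m \<epsilon> f f' \<and> small_homotopic L m \<epsilon> g g' \<and>
      (\<forall>x\<in>topspace K. \<forall>y\<in>topspace L. S x y \<longrightarrow> f' x \<noteq> g' y)"
    using assms(2) by (intro exI[of _ f'] exI[of _ g']) simp
qed

definition closed_rel :: "'k topology \<Rightarrow> 'l topology \<Rightarrow> ('k \<Rightarrow> 'l \<Rightarrow> bool) \<Rightarrow> bool" where
  "closed_rel K L R \<longleftrightarrow> closedin (prod_topology K L) {z \<in> topspace (prod_topology K L). R (fst z) (snd z)}"

text \<open>Once a closed relation is avoided, compactness leaves a positive margin, so a sufficiently
  small later homotopy keeps it avoided.\<close>

lemma avoidable_Un:
  assumes K: "compact_space K" and L: "compact_space L"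
    and R: "avoidable K L m R" and R': "avoidable K L m R'" and cl: "closed_rel K L R"
  shows "avoidable K L m (\<lambda>x y. R x y \<or> R' x y)"
  unfolding avoidable_def
proof (intro allI impI)
  fix \<epsilon> :: real and f g
  assume \<epsilon>: "0 < \<epsilon>" and fg: "continuous_map K (mtopology_of m) f \<and> continuous_map L (mtopology_of m) g"
  then obtain f1 g1 where f1: "small_homotopic K m (\<epsilon>/2) f f1" and g1: "small_homotopic L m (\<epsilon>/2) g g1"
    and ne1: "\<And>x y. x \<in> topspace K \<Longrightarrow> y \<in> topspace L \<Longrightarrow> R x y \<Longrightarrow> f1 x \<noteq> g1 y"
    using avoidableE[OF R, of "\<epsilon>/2" f g] by auto
  note f1c = small_homotopic_continuous(2)[OF f1] and g1c = small_homotopic_continuous(2)[OF g1]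
  let ?P = "prod_topology K L"
  let ?C = "{z \<in> topspace ?P. R (fst z) (snd z)}"
  have "compact_space ?P" using K L by (simp add: compact_space_prod_topology)
  moreover have "closedin ?P ?C" using cl by (simp add: closed_rel_def)
  moreover have "continuous_map ?P euclideanreal (\<lambda>z. mdist m (f1 (fst z)) (g1 (snd z)))"
    by (intro continuous_intros continuous_map_compose2[OF f1c] continuous_map_compose2[OF g1c] continuous_map_fst continuous_map_snd)
  moreover have "0 < mdist m (f1 (fst z)) (g1 (snd z))" if "z \<in> ?C" for z
  proof -
    have "fst z \<in> topspace K" "snd z \<in> topspace L" using that by auto
    then have "f1 (fst z) \<in> mspace m" "g1 (snd z) \<in> mspace m" "f1 (fst z) \<noteq> g1 (snd z)"
      using that ne1 continuous_map_in_topspace[OF f1c] continuous_map_in_topspace[OF g1c] by auto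
    then show ?thesis by (metis mdist_nonneg mdist_zero order_le_less)
  qed
  ultimately obtain \<eta> where \<eta>: "0 < \<eta>" "\<And>z. z \<in> ?C \<Longrightarrow> \<eta> \<le> mdist m (f1 (fst z)) (g1 (snd z))"
    using compact_positive_lower_bound[of ?P ?C "\<lambda>z. mdist m (f1 (fst z)) (g1 (snd z))"] by blast
  \<comment> \<open>The second perturbation changes distances by less than 2e, at most two thirds of
    the margin \<eta>; the other bound spends the remaining half of \<epsilon>.\<close>
  define e where "e = min (\<epsilon>/2) (\<eta>/3)"
  have e: "0 < e" "e \<le> \<epsilon>/2" "e \<le> \<eta>/3" using \<epsilon> \<eta> by (auto simp: e_def)
  obtain f2 g2 where f2: "small_homotopic K m e f1 f2" and g2: "small_homotopic L m e g1 g2"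
    and ne2: "\<And>x y. x \<in> topspace K \<Longrightarrow> y \<in> topspace L \<Longrightarrow> R' x y \<Longrightarrow> f2 x \<noteq> g2 y"
    using avoidableE[OF R' e(1) f1c g1c] by blast
  have "f2 x \<noteq> g2 y" if xy: "x \<in> topspace K" "y \<in> topspace L" and "R x y" for x y
  proof
    assume eq: "f2 x = g2 y"
    have S: "f1 x \<in> mspace m" "g1 y \<in> mspace m" "g2 y \<in> mspace m"
      using xy continuous_map_in_topspace[OF f1c] continuous_map_in_topspace[OF g1c]
         continuous_map_in_topspace[OF small_homotopic_continuous(2)[OF g2]] by auto
    have "\<eta> \<le> mdist m (f1 x) (g1 y)" using \<eta>(2)[of "(x,y)"] that by auto
    also have "\<dots> \<le> mdist m (f1 x) (f2 x) + mdist m (g1 y) (g2 y)"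
      using mdist_triangle[of "f1 x" m "g2 y" "g1 y"] S eq by (simp add: mdist_commute)
    also have "\<dots> < e + e"
      using small_homotopic_dist[OF f2 xy(1)] small_homotopic_dist[OF g2 xy(2)] by linarith
    finally show False using e \<eta> by linarith
  qed
  moreover have "small_homotopic K m \<epsilon> f f2" "small_homotopic L m \<epsilon> g g2"
    using small_homotopic_trans[OF f1 f2] small_homotopic_trans[OF g1 g2] e
      small_homotopic_mono[of _ m "\<epsilon>/2 + e" _ _ \<epsilon>] by auto
  ultimately show "\<exists>f' g'. small_homotopic K m \<epsilon> f f' \<and> small_homotopic L m \<epsilon> g g' \<and>
           (\<forall>x\<in>topspace K. \<forall>y\<in>topspace L. R x y \<or> R' x y \<longrightarrow> f' x \<noteq> g' y)"
    using ne2 by blast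
qed

lemma avoidable_finite_UN:
  assumes "finite I" "compact_space K" "compact_space L"
    and "\<And>i. i \<in> I \<Longrightarrow> avoidable K L m (R i)" "\<And>i. i \<in> I \<Longrightarrow> closed_rel K L (R i)"
  shows "avoidable K L m (\<lambda>x y. \<exists>i\<in>I. R i x y)"
  using assms(1,4,5)
proof (induction I rule: finite_induct)
  case empty
  show ?case
    unfolding avoidable_def by (auto intro!: small_homotopic_refl)
next
  case (insert i I)
  then have "avoidable K L m (\<lambda>x y. R i x y \<or> (\<exists>i\<in>I. R i x y))"
    by (intro avoidable_Un[OF assms(2,3)]) auto
  then show ?case by simp
qed

text \<open>The deformation carries \<open>x\<close> to \<open>r (e x)\<close> within time \<open>\<delta> x\<close>. Following it first and then a homotopy
  on \<open>K'\<close> gives a controlled homotopy extension from the zero set of \<open>\<delta>\<close>.\<close>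

definition pinching ::
    "'k topology \<Rightarrow> 'l topology \<Rightarrow> ('k \<Rightarrow> 'l) \<Rightarrow> ('k \<Rightarrow> real) \<Rightarrow> bool" where
  "pinching K K' e \<delta> \<longleftrightarrow> continuous_map K K' e \<and> continuous_map K euclideanreal \<delta> \<and>
     (\<forall>x\<in>topspace K. 0 \<le> \<delta> x) \<and>
     (\<exists>r p. continuous_map K' K r \<and> continuous_map (prod_topology K unit_interval) K p \<and>
        (\<forall>x\<in>topspace K. p (x, 0) = x \<and> (\<forall>s\<in>{0..1}. \<delta> x \<le> s \<longrightarrow> p (x, s) = r (e x))))"

text \<open>\<open>F\<close> has to be fixed before \<open>F'\<close> is known, since avoidability
  on the small spaces perturbs two such maps at once. The composite of \<open>f\<close> with
  \<open>r\<close> works: where the pinching is complete, \<open>f\<close> has been deformed into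
  \<open>F\<close> composed with \<open>e\<close>.\<close>

lemma pinching_extend:
  assumes K: "compact_space K" and pinch: "pinching K K' e \<delta>"
    and f: "continuous_map K (mtopology_of m) f" and \<epsilon>: "0 < \<epsilon>"
  obtains F where "continuous_map K' (mtopology_of m) F"
    "\<And>F'. small_homotopic K' m (\<epsilon>/2) F F' \<Longrightarrow>
       \<exists>f'. small_homotopic K m \<epsilon> f f' \<and> (\<forall>x\<in>topspace K. \<delta> x = 0 \<longrightarrow> f' x = F' (e x))"
proof -
  let ?P = "prod_topology K unit_interval"
  from pinch obtain r p where e: "continuous_map K K' e" and \<delta>: "continuous_map K euclideanreal \<delta>"
    and \<delta>0: "\<And>x. x \<in> topspace K \<Longrightarrow> 0 \<le> \<delta> x"
    and r: "continuous_map K' K r" and p: "continuous_map ?P K p"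
    and p0: "\<And>x. x \<in> topspace K \<Longrightarrow> p (x, 0) = x"
    and p1: "\<And>x s. x \<in> topspace K \<Longrightarrow> 0 \<le> s \<Longrightarrow> s \<le> 1 \<Longrightarrow> \<delta> x \<le> s \<Longrightarrow> p (x, s) = r (e x)"
    unfolding pinching_def by auto
  have fp: "continuous_map ?P (mtopology_of m) (\<lambda>z. f (p z))"
    using continuous_map_compose2[OF f p] .
  have fS: "f x \<in> mspace m" if "x \<in> topspace K" for x
    using continuous_map_in_topspace[OF f that] by simp
  \<comment> \<open>Up to time \<open>c\<close> the pinching uses only half of \<epsilon>; the other
    half is left for the homotopy on \<open>K'\<close>.\<close>
  obtain c where c: "0 < c" "c \<le> 1"
    and cs: "\<And>x s. x \<in> topspace K \<Longrightarrow> 0 \<le> s \<Longrightarrow> s \<le> c \<Longrightarrow> mdist m (f x) (f (p (x, s))) < \<epsilon>/2"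
  proof (rule compact_uniformly_small[OF K])
    show "continuous_map ?P euclideanreal (\<lambda>z. mdist m (f (fst z)) (f (p z)))"
      by (intro continuous_intros fp continuous_map_compose2[OF f] continuous_map_fst)
    show "mdist m (f (fst (x, 0))) (f (p (x, 0))) < \<epsilon>/2" if "x \<in> topspace K" for x
      using p0[OF that] mdist_self[OF fS[OF that]] \<epsilon> by simp
  qed auto
  show ?thesis
  proof (rule that)
    show frc: "continuous_map K' (mtopology_of m) (\<lambda>y. f (r y))"
      using continuous_map_compose2[OF f r] .
    fix F' assume "small_homotopic K' m (\<epsilon>/2) (\<lambda>y. f (r y)) F'"
    then obtain H where H: "continuous_map (prod_topology K' unit_interval) (mtopology_of m) H"
      and H0: "\<And>y. y \<in> topspace K' \<Longrightarrow> H (y, 0) = f (r y)" and H1: "\<And>y. y \<in> topspace K' \<Longrightarrow> H (y, 1) = F' y"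
      and Hs: "\<And>y t. y \<in> topspace K' \<Longrightarrow> 0 \<le> t \<Longrightarrow> t \<le> 1 \<Longrightarrow> mdist m (f (r y)) (H (y, t)) < \<epsilon>/2"
      unfolding small_homotopic_def by auto
    \<comment> \<open>The pinching runs at speed \<open>c\<close> until time \<delta>/c, and then
      \<open>H\<close> starts with this delay. Where \<delta> vanishes there is no delay and
      \<open>H\<close> is carried out in full; where \<delta> is at least \<open>c\<close>,
      \<open>H\<close> never starts.\<close>
    define G where "G = (\<lambda>z. if c * snd z \<le> \<delta> (fst z) then f (p (fst z, c * snd z))
                            else H (e (fst z), max 0 (snd z - \<delta> (fst z) / c)))"
    have snd: "continuous_map ?P euclideanreal snd"
      using continuous_map_snd[of K unit_interval] continuous_map_in_subtopology by blast
    have \<delta>f: "continuous_map ?P euclideanreal (\<lambda>z. \<delta> (fst z))"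
      by (intro continuous_map_compose2[OF \<delta>] continuous_map_fst)
    have T: "c * t \<le> c \<and> 0 \<le> c * t" if "0 \<le> t" "t \<le> 1" for t
      using that c by (auto intro: mult_left_le)
    have T': "\<delta> x / c \<ge> 0" if "x \<in> topspace K" for x using \<delta>0[OF that] c by simp
    have "continuous_map ?P (mtopology_of m) G"
      unfolding G_def
    proof (rule continuous_map_cases_le)
      show "continuous_map ?P euclideanreal (\<lambda>x. c * snd x)" by (intro continuous_intros snd)
      show "continuous_map ?P euclideanreal (\<lambda>x. \<delta> (fst x))" by (rule \<delta>f)
      show "continuous_map (subtopology ?P {x \<in> topspace ?P. c * snd x \<le> \<delta> (fst x)}) (mtopology_of m)
               (\<lambda>x. f (p (fst x, c * snd x)))"
      proof (intro continuous_map_from_subtopology continuous_map_compose2[OF fp])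
        have "0 \<le> c * snd z \<and> c * snd z \<le> 1" if "z \<in> topspace ?P" for z
          using that c by (auto intro: mult_le_one)
        moreover have "continuous_map ?P euclideanreal (\<lambda>x. c * snd x)" by (intro continuous_intros snd)
        ultimately show "continuous_map ?P ?P (\<lambda>x. (fst x, c * snd x))"
          by (simp only: continuous_map_paired continuous_map_unit_interval continuous_map_fst) simp
      qed
      have "max 0 (snd z - \<delta> (fst z) / c) \<le> 1" if "z \<in> topspace ?P" for z
        using that T'[of "fst z"] by auto
      moreover have "continuous_map ?P euclideanreal (\<lambda>x. max 0 (snd x - \<delta> (fst x) / c))"
        using c by (intro continuous_intros snd \<delta>f) simp
      moreover have "continuous_map ?P K' (\<lambda>x. e (fst x))"
        by (rule continuous_map_compose2[OF e continuous_map_fst])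
      ultimately have "continuous_map ?P (prod_topology K' unit_interval) (\<lambda>x. (e (fst x), max 0 (snd x - \<delta> (fst x) / c)))"
        by (simp only: continuous_map_paired continuous_map_unit_interval) simp
      then show "continuous_map (subtopology ?P {x \<in> topspace ?P. \<delta> (fst x) \<le> c * snd x}) (mtopology_of m)
               (\<lambda>x. H (e (fst x), max 0 (snd x - \<delta> (fst x) / c)))"
        by (intro continuous_map_from_subtopology continuous_map_compose2[OF H])
      fix z assume z: "z \<in> topspace ?P" and eq: "c * snd z = \<delta> (fst z)"
      have zK: "fst z \<in> topspace K" "0 \<le> snd z" "snd z \<le> 1" using z by auto
      then have "p (fst z, c * snd z) = r (e (fst z))"
        using p1[OF zK(1), of "c * snd z"] T[OF zK(2,3)] c eq by auto
      moreover have "snd z - \<delta> (fst z) / c = 0" using eq c by (simp add: field_simps)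
      ultimately show "f (p (fst z, c * snd z)) = H (e (fst z), max 0 (snd z - \<delta> (fst z) / c))"
        using H0[OF continuous_map_in_topspace[OF e zK(1)]] by simp
    qed
    moreover have "mdist m (f x) (G (x, t)) < \<epsilon>" if x: "x \<in> topspace K" and t: "0 \<le> t" "t \<le> 1" for x t
    proof (cases "c * t \<le> \<delta> x")
      case True
      then show ?thesis using cs[OF x, of "c * t"] T[OF t] \<epsilon> by (simp add: G_def)
    next
      case False
      define s where "s = max 0 (t - \<delta> x / c)"
      have s: "0 \<le> s" "s \<le> 1" using t T'[OF x] by (auto simp: s_def)
      have ex: "e x \<in> topspace K'" using continuous_map_in_topspace[OF e x] .
      have S: "f (r (e x)) \<in> mspace m" "H (e x, s) \<in> mspace m"
        using continuous_map_in_topspace[OF frc ex] continuous_map_in_topspace[OF H, of "(e x, s)"] ex s by auto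
      have "p (x, c * t) = r (e x)" using p1[OF x, of "c * t"] False T[OF t] c by auto
      then have "mdist m (f x) (f (r (e x))) < \<epsilon>/2" using cs[OF x, of "c * t"] T[OF t] by simp
      then have "mdist m (f x) (H (e x, s)) < \<epsilon>"
        using mdist_triangle[OF fS[OF x] S] Hs[OF ex s] by linarith
      then show ?thesis using False by (simp add: G_def s_def)
    qed
    moreover have "G (x, 0) = f x" if "x \<in> topspace K" for x
      using \<delta>0[OF that] p0[OF that] by (simp add: G_def)
    ultimately have "small_homotopic K m \<epsilon> f (\<lambda>x. G (x, 1))"
      unfolding small_homotopic_def by (intro exI[of _ G]) auto
    moreover have "G (x, 1) = F' (e x)" if "x \<in> topspace K" "\<delta> x = 0" for x
      using that c H1 continuous_map_in_topspace[OF e] by (simp add: G_def)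
    ultimately show "\<exists>f'. small_homotopic K m \<epsilon> f f' \<and> (\<forall>x\<in>topspace K. \<delta> x = 0 \<longrightarrow> f' x = F' (e x))"
      by blast
  qed
qed

text \<open>Separation takes place on the small spaces, and the perturbed maps are pulled back by
  \<open>e\<close> and \<open>e'\<close>. The extension agrees with these pullbacks on the zero sets
  of \<delta> and \<delta>', which is why the zero sets enter the relation.\<close>

lemma avoidable_pinching:
  assumes K: "compact_space K" and L: "compact_space L"
    and PK: "pinching K K' e \<delta>" and PL: "pinching L L' e' \<delta>'"
    and R: "avoidable K' L' m R"
  shows "avoidable K L m (\<lambda>x y. \<delta> x = 0 \<and> \<delta>' y = 0 \<and> R (e x) (e' y))"
  unfolding avoidable_def
proof (intro allI impI)
  fix \<epsilon> :: real and f g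
  assume \<epsilon>: "0 < \<epsilon>" and fg: "continuous_map K (mtopology_of m) f \<and> continuous_map L (mtopology_of m) g"
  obtain F where F: "continuous_map K' (mtopology_of m) F"
    and F': "\<And>F'. small_homotopic K' m (\<epsilon>/2) F F' \<Longrightarrow>
       \<exists>f'. small_homotopic K m \<epsilon> f f' \<and> (\<forall>x\<in>topspace K. \<delta> x = 0 \<longrightarrow> f' x = F' (e x))"
    by (rule pinching_extend[OF K PK conjunct1[OF fg] \<epsilon>], rule that) blast+
  obtain G where G: "continuous_map L' (mtopology_of m) G"
    and G': "\<And>F'. small_homotopic L' m (\<epsilon>/2) G F' \<Longrightarrow>
       \<exists>f'. small_homotopic L m \<epsilon> g f' \<and> (\<forall>x\<in>topspace L. \<delta>' x = 0 \<longrightarrow> f' x = F' (e' x))"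
    by (rule pinching_extend[OF L PL conjunct2[OF fg] \<epsilon>], rule that) blast+
  obtain F1 G1 where FG1: "small_homotopic K' m (\<epsilon>/2) F F1" "small_homotopic L' m (\<epsilon>/2) G G1"
    "\<And>x y. x \<in> topspace K' \<Longrightarrow> y \<in> topspace L' \<Longrightarrow> R x y \<Longrightarrow> F1 x \<noteq> G1 y"
    using avoidableE[OF R, of "\<epsilon>/2" F G] \<epsilon> F G by auto
  have "e x \<in> topspace K'" "e' y \<in> topspace L'" if "x \<in> topspace K" "y \<in> topspace L" for x y
    using that PK PL by (auto simp: pinching_def intro: continuous_map_in_topspace)
  note eT = this
  obtain f' where f': "small_homotopic K m \<epsilon> f f'" "\<And>x. x \<in> topspace K \<Longrightarrow> \<delta> x = 0 \<Longrightarrow> f' x = F1 (e x)"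
    using F'[OF FG1(1)] by blast
  obtain g' where g': "small_homotopic L m \<epsilon> g g'" "\<And>y. y \<in> topspace L \<Longrightarrow> \<delta>' y = 0 \<Longrightarrow> g' y = G1 (e' y)"
    using G'[OF FG1(2)] by blast
  show "\<exists>f' g'. small_homotopic K m \<epsilon> f f' \<and> small_homotopic L m \<epsilon> g g' \<and>
        (\<forall>x\<in>topspace K. \<forall>y\<in>topspace L. \<delta> x = 0 \<and> \<delta>' y = 0 \<and> R (e x) (e' y) \<longrightarrow> f' x \<noteq> g' y)"
    using f' g' FG1(3) eT by (intro exI[of _ f'] exI[of _ g']) simp
qed

subsection \<open>The fiberwise property and avoidable relations\<close>

lemma continuous_map_reverse:
  assumes "continuous_map (prod_topology K unit_interval) X h"
  shows "continuous_map (prod_topology K unit_interval) X (\<lambda>z. h (fst z, 1 - snd z))"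
proof (rule continuous_map_compose2[OF assms])
  have "continuous_map (prod_topology K unit_interval) euclideanreal snd"
    using continuous_map_snd[of K unit_interval] continuous_map_in_subtopology by blast
  then have "continuous_map (prod_topology K unit_interval) euclideanreal (\<lambda>z. 1 - snd z)"
    by (intro continuous_intros)
  then show "continuous_map (prod_topology K unit_interval) (prod_topology K unit_interval) (\<lambda>z. (fst z, 1 - snd z))"
    by (simp only: continuous_map_paired continuous_map_unit_interval continuous_map_fst) auto
qed

text \<open>\<epsilon> is a Lebesgue number of the cover on the compact image of \<open>f\<close>.
  The homotopy is run backwards because \<open>cover_homotopic\<close> expects the perturbed map
  first.\<close>

lemma small_homotopic_imp_cover_homotopic:
  assumes K: "compact_space K" and f: "continuous_map K (mtopology_of m) f"
    and \<U>: "open_cover (mtopology_of m) \<U>"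
  obtains \<epsilon> where "0 < \<epsilon>" "\<And>g. small_homotopic K m \<epsilon> f g \<Longrightarrow> cover_homotopic K (mtopology_of m) \<U> g f"
proof -
  have "compactin (mtopology_of m) (f ` topspace K)"
    using K f image_compactin unfolding compact_space_def by blast
  moreover have "f ` topspace K \<subseteq> \<Union>\<U>"
    using \<U> continuous_map_in_topspace[OF f] by (auto simp: open_cover_def)
  ultimately obtain \<epsilon> where \<epsilon>: "0 < \<epsilon>" "\<forall>y\<in>f ` topspace K. \<exists>U\<in>\<U>. mball_of m y \<epsilon> \<subseteq> U"
    using Metric_space.lebesgue_number[OF Metric_space_mspace_mdist, of m "f ` topspace K" \<U>] \<U>
    by (auto simp: mtopology_of_def mball_of_def open_cover_def)
  show ?thesis
  proof (rule that[OF \<epsilon>(1)])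
    fix g assume "small_homotopic K m \<epsilon> f g"
    then obtain h where h: "continuous_map (prod_topology K unit_interval) (mtopology_of m) h"
      and h01: "\<And>x. x \<in> topspace K \<Longrightarrow> h (x, 0) = f x" "\<And>x. x \<in> topspace K \<Longrightarrow> h (x, 1) = g x"
      and hs: "\<And>x t. x \<in> topspace K \<Longrightarrow> t \<in> {0..1} \<Longrightarrow> mdist m (f x) (h (x, t)) < \<epsilon>"
      unfolding small_homotopic_def by blast
    have "\<exists>U\<in>\<U>. (\<lambda>z. h (fst z, 1 - snd z)) ` ({x} \<times> {0..1}) \<subseteq> U" if x: "x \<in> topspace K" for x
    proof -
      have "h (x, 1 - t) \<in> mball_of m (f x) \<epsilon>" if "t \<in> {0..1}" for t
        using continuous_map_in_topspace[OF f x] continuous_map_in_topspace[OF h, of "(x, 1 - t)"] hs[OF x, of "1 - t"] x that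
        by auto
      moreover obtain U where "U \<in> \<U>" "mball_of m (f x) \<epsilon> \<subseteq> U" using \<epsilon>(2) x by blast
      ultimately show ?thesis by (intro bexI[of _ U] image_subsetI) (simp_all add: mem_Times_iff subset_iff del: in_mball_of)
    qed
    then show "cover_homotopic K (mtopology_of m) \<U> g f"
      unfolding cover_homotopic_def using continuous_map_reverse[OF h] h01
      by (intro exI[of _ "\<lambda>z. h (fst z, 1 - snd z)"]) simp
  qed
qed

lemma open_cover_balls:
  "0 < r \<Longrightarrow> open_cover (mtopology_of m) ((\<lambda>x. mball_of m x r) ` mspace m)"
  unfolding open_cover_def
proof (intro conjI ballI subset_antisym subsetI)
  fix U assume "U \<in> (\<lambda>x. mball_of m x r) ` mspace m"
  then show "openin (mtopology_of m) U"
    by (auto simp: mtopology_of_def mball_of_def Metric_space.openin_mball[OF Metric_space_mspace_mdist])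
next
  fix x assume "0 < r" "x \<in> topspace (mtopology_of m)"
  then show "x \<in> \<Union>((\<lambda>x. mball_of m x r) ` mspace m)"
    by (auto intro!: bexI[of _ x] simp: mdist_self)
qed auto

text \<open>Two points of a common ball of radius \<epsilon>/2 are less than \<epsilon> apart.
  Reversing the homotopy makes \<open>f\<close> the map from which distances are measured.\<close>

lemma cover_homotopic_balls_imp_small_homotopic:
  assumes "cover_homotopic K (mtopology_of m) ((\<lambda>x. mball_of m x (\<epsilon>/2)) ` mspace m) g f"
  shows "small_homotopic K m \<epsilon> f g"
proof -
  obtain h where h: "continuous_map (prod_topology K unit_interval) (mtopology_of m) h"
    and h01: "\<And>x. x \<in> topspace K \<Longrightarrow> h (x, 0) = g x" "\<And>x. x \<in> topspace K \<Longrightarrow> h (x, 1) = f x"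
    and hU: "\<And>x. x \<in> topspace K \<Longrightarrow> \<exists>y\<in>mspace m. h ` ({x} \<times> {0..1}) \<subseteq> mball_of m y (\<epsilon>/2)"
    using assms unfolding cover_homotopic_def by auto
  have "mdist m (f x) (h (x, 1 - t)) < \<epsilon>" if x: "x \<in> topspace K" and t: "t \<in> {0..1}" for x t
  proof -
    obtain y where y: "y \<in> mspace m" "h ` ({x} \<times> {0..1}) \<subseteq> mball_of m y (\<epsilon>/2)" using hU[OF x] by blast
    have "h (x, 1) \<in> mball_of m y (\<epsilon>/2)" "h (x, 1 - t) \<in> mball_of m y (\<epsilon>/2)"
      by (rule subsetD[OF y(2)], use t in force)+
    then show ?thesis
      using mdist_triangle[of "h (x, 1)" m y "h (x, 1 - t)"] h01(2)[OF x] by (simp add: mdist_commute)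
  qed
  then show ?thesis
    unfolding small_homotopic_def using continuous_map_reverse[OF h] h01
    by (intro exI[of _ "\<lambda>z. h (fst z, 1 - snd z)"]) simp
qed

section \<open>Cubes of finite and infinite dimension\<close>

lemma topspace_cube: "topspace (cube n) = (\<Pi>\<^sub>E i\<in>{i. enat i < n}. {0..1})"
  by (simp add: cube_def)

lemma compact_cube: "compact_space (cube n)"
  by (simp add: cube_def compact_space_product_topology compact_space_subtopology)

lemma Hausdorff_cube: "Hausdorff_space (cube n)"
  by (simp add: cube_def Hausdorff_space_product_topology Hausdorff_space_subtopology)

lemma metrizable_cube: "metrizable_space (cube n)"
  by (simp add: cube_def metrizable_space_product_topology metrizable_space_subtopology metrizable_space_euclidean)

lemma continuous_map_cube:
  "continuous_map K (cube n) f \<longleftrightarrow> (\<forall>x\<in>topspace K. f x \<in> topspace (cube n)) \<and>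
     (\<forall>i. enat i < n \<longrightarrow> continuous_map K euclideanreal (\<lambda>x. f x i))"
  unfolding topspace_cube unfolding cube_def
  by (auto simp: continuous_map_componentwise continuous_map_unit_interval PiE_iff image_subset_iff)

lemma continuous_map_cube_coord:
  assumes "continuous_map K (cube n) f" "enat i < n"
  shows "continuous_map K euclideanreal (\<lambda>x. f x i)"
  using assms by (simp add: continuous_map_cube)

abbreviation bicube :: "enat \<Rightarrow> enat \<Rightarrow> ((nat \<Rightarrow> real) \<times> (nat \<Rightarrow> real)) topology" where
  "bicube m n \<equiv> prod_topology (cube m) (cube n)"

lemma compact_bicube: "compact_space (bicube m n)"
  by (simp add: compact_space_prod_topology compact_cube)

text \<open>The cover by small balls gives one direction, a Lebesgue number for each of the two maps
  the other. In particular the right-hand side is the same for all metrics inducing the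
  topology.\<close>

lemma fiberwise_DD_iff_avoidable:
  "fiberwise_DD m n k (mtopology_of X) \<longleftrightarrow> avoidable (bicube m n) (bicube m k) X (\<lambda>p q. fst p = fst q)"
proof
  assume DD: "fiberwise_DD m n k (mtopology_of X)"
  show "avoidable (bicube m n) (bicube m k) X (\<lambda>p q. fst p = fst q)"
    unfolding avoidable_def
  proof (intro allI impI)
    fix \<epsilon> :: real and f g
    assume \<epsilon>: "0 < \<epsilon>" and fg: "continuous_map (bicube m n) (mtopology_of X) f \<and> continuous_map (bicube m k) (mtopology_of X) g"
    let ?U = "(\<lambda>x. mball_of X x (\<epsilon>/2)) ` mspace X"
    have "open_cover (mtopology_of X) ?U" using \<epsilon> by (intro open_cover_balls) auto
    then obtain f' g' where 
       "cover_homotopic (bicube m n) (mtopology_of X) ?U f' f" "cover_homotopic (bicube m k) (mtopology_of X) ?U g' g"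
       and ne: "\<forall>z\<in>topspace (cube m). f' ` ({z} \<times> topspace (cube n)) \<inter> g' ` ({z} \<times> topspace (cube k)) = {}"
      using DD fg unfolding fiberwise_DD_def by blast
    then have "small_homotopic (bicube m n) X \<epsilon> f f'" "small_homotopic (bicube m k) X \<epsilon> g g'"
      by (auto intro: cover_homotopic_balls_imp_small_homotopic)
    moreover have "f' p \<noteq> g' q" if "p \<in> topspace (bicube m n)" "q \<in> topspace (bicube m k)" "fst p = fst q" for p q
      using ne that by (cases p; cases q) auto
    ultimately show "\<exists>f' g'. small_homotopic (bicube m n) X \<epsilon> f f' \<and> small_homotopic (bicube m k) X \<epsilon> g g' \<and>
       (\<forall>p\<in>topspace (bicube m n). \<forall>q\<in>topspace (bicube m k). fst p = fst q \<longrightarrow> f' p \<noteq> g' q)"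
      by blast
  qed
next
  assume av: "avoidable (bicube m n) (bicube m k) X (\<lambda>p q. fst p = fst q)"
  show "fiberwise_DD m n k (mtopology_of X)"
    unfolding fiberwise_DD_def
  proof (intro allI impI)
    fix \<U> f g
    assume a: "open_cover (mtopology_of X) \<U> \<and>
       continuous_map (bicube m n) (mtopology_of X) f \<and> continuous_map (bicube m k) (mtopology_of X) g"
    then have U: "open_cover (mtopology_of X) \<U>"
      and f: "continuous_map (bicube m n) (mtopology_of X) f" and g: "continuous_map (bicube m k) (mtopology_of X) g"
      by auto
    obtain \<epsilon>1 where \<epsilon>1: "0 < \<epsilon>1" "\<And>f'. small_homotopic (bicube m n) X \<epsilon>1 f f' \<Longrightarrow> cover_homotopic (bicube m n) (mtopology_of X) \<U> f' f"
      by (rule small_homotopic_imp_cover_homotopic[OF compact_bicube f U], rule that) blast+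
    obtain \<epsilon>2 where \<epsilon>2: "0 < \<epsilon>2" "\<And>g'. small_homotopic (bicube m k) X \<epsilon>2 g g' \<Longrightarrow> cover_homotopic (bicube m k) (mtopology_of X) \<U> g' g"
      by (rule small_homotopic_imp_cover_homotopic[OF compact_bicube g U], rule that) blast+
    have m0: "0 < min \<epsilon>1 \<epsilon>2" using \<epsilon>1 \<epsilon>2 by simp
    obtain f' g' where f': "small_homotopic (bicube m n) X (min \<epsilon>1 \<epsilon>2) f f'" and g': "small_homotopic (bicube m k) X (min \<epsilon>1 \<epsilon>2) g g'"
      and ne: "\<And>p q. p \<in> topspace (bicube m n) \<Longrightarrow> q \<in> topspace (bicube m k) \<Longrightarrow> fst p = fst q \<Longrightarrow> f' p \<noteq> g' q"
      by (rule avoidableE[OF av m0 f g], rule that) blast+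
    have "cover_homotopic (bicube m n) (mtopology_of X) \<U> f' f" "cover_homotopic (bicube m k) (mtopology_of X) \<U> g' g"
      using \<epsilon>1(2)[OF small_homotopic_mono[OF f']] \<epsilon>2(2)[OF small_homotopic_mono[OF g']] by auto
    moreover have "f' ` ({z} \<times> topspace (cube n)) \<inter> g' ` ({z} \<times> topspace (cube k)) = {}" if "z \<in> topspace (cube m)" for z
    proof -
      have "f' (z, x) \<noteq> g' (z, y)" if "x \<in> topspace (cube n)" "y \<in> topspace (cube k)" for x y
        using ne[of "(z, x)" "(z, y)"] that \<open>z \<in> topspace (cube m)\<close> by simp
      then show ?thesis by auto
    qed
    ultimately show "\<exists>f' g'. continuous_map (bicube m n) (mtopology_of X) f' \<and>
           continuous_map (bicube m k) (mtopology_of X) g' \<and>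
           cover_homotopic (bicube m n) (mtopology_of X) \<U> f' f \<and>
           cover_homotopic (bicube m k) (mtopology_of X) \<U> g' g \<and>
           (\<forall>z\<in>topspace (cube m). f' ` ({z} \<times> topspace (cube n)) \<inter> g' ` ({z} \<times> topspace (cube k)) = {})"
      using small_homotopic_continuous(2)[OF f'] small_homotopic_continuous(2)[OF g'] by blast
  qed
qed

lemma metrizable_obtain_metric:
  assumes "metrizable_space X"
  obtains m where "X = mtopology_of m"
  using assms unfolding metrizable_space_def by (metis Metric_space.mtopology_of)

lemma fiberwise_DD_sym: "fiberwise_DD m n k X \<Longrightarrow> fiberwise_DD m k n X"
  unfolding fiberwise_DD_def
proof (intro allI impI)
  fix \<U> f g
  assume DD: "\<forall>\<U> f g. open_cover X \<U> \<and> continuous_map (bicube m n) X f \<and> continuous_map (bicube m k) X g \<longrightarrow>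
        (\<exists>f' g'. continuous_map (bicube m n) X f' \<and> continuous_map (bicube m k) X g' \<and>
           cover_homotopic (bicube m n) X \<U> f' f \<and> cover_homotopic (bicube m k) X \<U> g' g \<and>
           (\<forall>z\<in>topspace (cube m). f' ` ({z} \<times> topspace (cube n)) \<inter> g' ` ({z} \<times> topspace (cube k)) = {}))"
    and "open_cover X \<U> \<and> continuous_map (bicube m k) X f \<and> continuous_map (bicube m n) X g"
  then obtain g' f' where "continuous_map (bicube m n) X g' \<and> continuous_map (bicube m k) X f' \<and>
           cover_homotopic (bicube m n) X \<U> g' g \<and> cover_homotopic (bicube m k) X \<U> f' f \<and>
           (\<forall>z\<in>topspace (cube m). g' ` ({z} \<times> topspace (cube n)) \<inter> f' ` ({z} \<times> topspace (cube k)) = {})"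
    by blast
  then show "\<exists>f' g'. continuous_map (bicube m k) X f' \<and> continuous_map (bicube m n) X g' \<and>
           cover_homotopic (bicube m k) X \<U> f' f \<and> cover_homotopic (bicube m n) X \<U> g' g \<and>
           (\<forall>z\<in>topspace (cube m). f' ` ({z} \<times> topspace (cube k)) \<inter> g' ` ({z} \<times> topspace (cube n)) = {})"
    by (intro exI[of _ f'] exI[of _ g']) (simp add: Int_commute)
qed

section \<open>Homeomorphic spaces and products\<close>

lemma open_cover_preimage:
  assumes "open_cover Y \<V>" "continuous_map X Y a"
  shows "open_cover X ((\<lambda>V. {x \<in> topspace X. a x \<in> V}) ` \<V>)"
  using assms continuous_map_in_topspace[OF assms(2)]
  unfolding open_cover_def by (auto intro: openin_continuous_map_preimage)

lemma cover_homotopic_image: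
  assumes "cover_homotopic K X ((\<lambda>V. {x \<in> topspace X. a x \<in> V}) ` \<V>) f g" "continuous_map X Y a"
  shows "cover_homotopic K Y \<V> (\<lambda>x. a (f x)) (\<lambda>x. a (g x))"
proof -
  obtain h where h: "continuous_map (prod_topology K unit_interval) X h"
    and h01: "\<And>x. x \<in> topspace K \<Longrightarrow> h (x, 0) = f x \<and> h (x, 1) = g x"
    and hU: "\<And>x. x \<in> topspace K \<Longrightarrow> \<exists>V\<in>\<V>. h ` ({x} \<times> {0..1}) \<subseteq> {x \<in> topspace X. a x \<in> V}"
    using assms(1) unfolding cover_homotopic_def by auto
  have "\<exists>V\<in>\<V>. (\<lambda>z. a (h z)) ` ({x} \<times> {0..1}) \<subseteq> V" if "x \<in> topspace K" for x
    using hU[OF that] by blast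
  then show ?thesis
    unfolding cover_homotopic_def using continuous_map_compose2[OF assms(2) h] h01
    by (intro exI[of _ "\<lambda>z. a (h z)"]) simp
qed

lemma cover_homotopic_cong:
  assumes "cover_homotopic K X \<U> f g" "\<And>x. x \<in> topspace K \<Longrightarrow> f x = f' x" "\<And>x. x \<in> topspace K \<Longrightarrow> g x = g' x"
  shows "cover_homotopic K X \<U> f' g'"
  using assms unfolding cover_homotopic_def by (auto cong: conj_cong)

text \<open>Covers are pulled back along \<open>a\<close> and homotopies pushed forward, so the
  transfer is purely topological.\<close>

lemma fiberwise_DD_homeomorphic:
  assumes DD: "fiberwise_DD m n k X" and hom: "homeomorphic_maps X Y a b"
  shows "fiberwise_DD m n k Y"
  unfolding fiberwise_DD_def
proof (intro allI impI)
  fix \<V> f g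
  assume as: "open_cover Y \<V> \<and> continuous_map (bicube m n) Y f \<and> continuous_map (bicube m k) Y g"
  have a: "continuous_map X Y a" and b: "continuous_map Y X b"
    and ba: "\<And>x. x \<in> topspace X \<Longrightarrow> b (a x) = x" and ab: "\<And>y. y \<in> topspace Y \<Longrightarrow> a (b y) = y"
    using hom unfolding homeomorphic_maps_def by auto
  let ?U = "(\<lambda>V. {x \<in> topspace X. a x \<in> V}) ` \<V>"
  have "open_cover X ?U" "continuous_map (bicube m n) X (\<lambda>z. b (f z))" "continuous_map (bicube m k) X (\<lambda>z. b (g z))"
    using as open_cover_preimage[OF _ a] continuous_map_compose2[OF b] by auto
  then obtain f' g' where f'g': "continuous_map (bicube m n) X f'" "continuous_map (bicube m k) X g'"
     and H: "cover_homotopic (bicube m n) X ?U f' (\<lambda>z. b (f z))" "cover_homotopic (bicube m k) X ?U g' (\<lambda>z. b (g z))"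
     and ne: "\<forall>z\<in>topspace (cube m). f' ` ({z} \<times> topspace (cube n)) \<inter> g' ` ({z} \<times> topspace (cube k)) = {}"
    using DD unfolding fiberwise_DD_def by blast
  have "a (f' (z, x)) \<noteq> a (g' (z, y))" if "z \<in> topspace (cube m)" "x \<in> topspace (cube n)" "y \<in> topspace (cube k)" for z x y
  proof -
    have "f' (z, x) \<noteq> g' (z, y)" using ne that by blast
    moreover have "f' (z, x) \<in> topspace X" "g' (z, y) \<in> topspace X"
      using that f'g'[THEN continuous_map_in_topspace] by auto
    ultimately show ?thesis by (metis ba)
  qed
  moreover have "cover_homotopic (bicube m n) Y \<V> (\<lambda>z. a (f' z)) f" "cover_homotopic (bicube m k) Y \<V> (\<lambda>z. a (g' z)) g"
    using cover_homotopic_cong[OF cover_homotopic_image[OF H(1) a], of "\<lambda>z. a (f' z)" f]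
      cover_homotopic_cong[OF cover_homotopic_image[OF H(2) a], of "\<lambda>z. a (g' z)" g]
      ab[OF continuous_map_in_topspace[OF conjunct1[OF conjunct2[OF as]]]]
      ab[OF continuous_map_in_topspace[OF conjunct2[OF conjunct2[OF as]]]] by blast+
  ultimately show "\<exists>f' g'. continuous_map (bicube m n) Y f' \<and> continuous_map (bicube m k) Y g' \<and>
           cover_homotopic (bicube m n) Y \<V> f' f \<and> cover_homotopic (bicube m k) Y \<V> g' g \<and>
           (\<forall>z\<in>topspace (cube m). f' ` ({z} \<times> topspace (cube n)) \<inter> g' ` ({z} \<times> topspace (cube k)) = {})"
    using continuous_map_compose2[OF a] f'g' 
    by (intro exI[of _ "\<lambda>z. a (f' z)"] exI[of _ "\<lambda>z. a (g' z)"]) auto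
qed

text \<open>Different reparametrisations are used in the two factors, and it is enough that one of
  the two separations catches each related pair. All data may depend on \<epsilon> and on the maps,
  because the grids used below are chosen only after the moduli of continuity.\<close>

lemma avoidable_prod:
  assumes "\<And>\<epsilon> f1 f2 g1 g2. 0 < \<epsilon> \<Longrightarrow> continuous_map K (mtopology_of X) f1 \<Longrightarrow> continuous_map K (mtopology_of Y) f2 \<Longrightarrow>
      continuous_map L (mtopology_of X) g1 \<Longrightarrow> continuous_map L (mtopology_of Y) g2 \<Longrightarrow>
      \<exists>\<phi>1 \<phi>2 \<psi>1 \<psi>2 R1 R2. continuous_map K K \<phi>1 \<and> continuous_map K K \<phi>2 \<and> continuous_map L L \<psi>1 \<and> continuous_map L L \<psi>2 \<and>
        small_homotopic K X \<epsilon> f1 (\<lambda>x. f1 (\<phi>1 x)) \<and> small_homotopic K Y \<epsilon> f2 (\<lambda>x. f2 (\<phi>2 x)) \<and>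
        small_homotopic L X \<epsilon> g1 (\<lambda>x. g1 (\<psi>1 x)) \<and> small_homotopic L Y \<epsilon> g2 (\<lambda>x. g2 (\<psi>2 x)) \<and>
        avoidable K L X R1 \<and> avoidable K L Y R2 \<and>
        (\<forall>x\<in>topspace K. \<forall>y\<in>topspace L. R x y \<longrightarrow> R1 (\<phi>1 x) (\<psi>1 y) \<or> R2 (\<phi>2 x) (\<psi>2 y))"
  shows "avoidable K L (prod_metric X Y) R"
  unfolding avoidable_def
proof (intro allI impI)
  fix \<epsilon> :: real and f g
  assume \<epsilon>: "0 < \<epsilon>" and fg: "continuous_map K (mtopology_of (prod_metric X Y)) f \<and> continuous_map L (mtopology_of (prod_metric X Y)) g"
  define f1 f2 g1 g2 where "f1 = fst \<circ> f" and "f2 = snd \<circ> f" and "g1 = fst \<circ> g" and "g2 = snd \<circ> g"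
  have c: "continuous_map K (mtopology_of X) f1" "continuous_map K (mtopology_of Y) f2"
      "continuous_map L (mtopology_of X) g1" "continuous_map L (mtopology_of Y) g2"
    using fg by (auto simp: continuous_map_pairwise f1_def f2_def g1_def g2_def)
  \<comment> \<open>Each component undergoes two homotopies, the reparametrisation and the
    reparametrised separation, and pairing the components doubles the bound.\<close>
  have e: "0 < \<epsilon>/4" using \<epsilon> by simp
  obtain \<phi>1 \<phi>2 \<psi>1 \<psi>2 R1 R2 where
     p: "continuous_map K K \<phi>1" "continuous_map K K \<phi>2" "continuous_map L L \<psi>1" "continuous_map L L \<psi>2"
     and h: "small_homotopic K X (\<epsilon>/4) f1 (\<lambda>x. f1 (\<phi>1 x))" "small_homotopic K Y (\<epsilon>/4) f2 (\<lambda>x. f2 (\<phi>2 x))"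
        "small_homotopic L X (\<epsilon>/4) g1 (\<lambda>x. g1 (\<psi>1 x))" "small_homotopic L Y (\<epsilon>/4) g2 (\<lambda>x. g2 (\<psi>2 x))"
     and R1: "avoidable K L X R1" and R2: "avoidable K L Y R2"
     and R: "\<forall>x\<in>topspace K. \<forall>y\<in>topspace L. R x y \<longrightarrow> R1 (\<phi>1 x) (\<psi>1 y) \<or> R2 (\<phi>2 x) (\<psi>2 y)"
    using assms[OF e c] by blast
  obtain f1' g1' where 1: "small_homotopic K X (\<epsilon>/4) f1 f1'" "small_homotopic L X (\<epsilon>/4) g1 g1'"
    "\<And>x y. x \<in> topspace K \<Longrightarrow> y \<in> topspace L \<Longrightarrow> R1 x y \<Longrightarrow> f1' x \<noteq> g1' y"
    using avoidableE[OF R1 e c(1,3)] by blast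
  obtain f2' g2' where 2: "small_homotopic K Y (\<epsilon>/4) f2 f2'" "small_homotopic L Y (\<epsilon>/4) g2 g2'"
    "\<And>x y. x \<in> topspace K \<Longrightarrow> y \<in> topspace L \<Longrightarrow> R2 x y \<Longrightarrow> f2' x \<noteq> g2' y"
    using avoidableE[OF R2 e c(2,4)] by blast
  have "small_homotopic K (prod_metric X Y) \<epsilon> (\<lambda>x. (f1 x, f2 x)) (\<lambda>x. (f1' (\<phi>1 x), f2' (\<phi>2 x)))"
    using small_homotopic_pair[OF small_homotopic_trans[OF h(1) small_homotopic_compose[OF 1(1) p(1)]]
       small_homotopic_trans[OF h(2) small_homotopic_compose[OF 2(1) p(2)]]] by simp
  moreover have "small_homotopic L (prod_metric X Y) \<epsilon> (\<lambda>x. (g1 x, g2 x)) (\<lambda>x. (g1' (\<psi>1 x), g2' (\<psi>2 x)))"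
    using small_homotopic_pair[OF small_homotopic_trans[OF h(3) small_homotopic_compose[OF 1(2) p(3)]]
       small_homotopic_trans[OF h(4) small_homotopic_compose[OF 2(2) p(4)]]] by simp
  moreover have "(f1' (\<phi>1 x), f2' (\<phi>2 x)) \<noteq> (g1' (\<psi>1 y), g2' (\<psi>2 y))"
    if "x \<in> topspace K" "y \<in> topspace L" "R x y" for x y
    using R that 1(3)[of "\<phi>1 x" "\<psi>1 y"] 2(3)[of "\<phi>2 x" "\<psi>2 y"]
       continuous_map_in_topspace[OF p(1), of x] continuous_map_in_topspace[OF p(2), of x]
       continuous_map_in_topspace[OF p(3), of y] continuous_map_in_topspace[OF p(4), of y] by auto
  moreover have "(\<lambda>x. (f1 x, f2 x)) = f" "(\<lambda>x. (g1 x, g2 x)) = g"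
    by (auto simp: f1_def f2_def g1_def g2_def)
  ultimately show "\<exists>f' g'. small_homotopic K (prod_metric X Y) \<epsilon> f f' \<and> small_homotopic L (prod_metric X Y) \<epsilon> g g' \<and>
           (\<forall>x\<in>topspace K. \<forall>y\<in>topspace L. R x y \<longrightarrow> f' x \<noteq> g' y)"
    by (intro exI[of _ "\<lambda>x. (f1' (\<phi>1 x), f2' (\<phi>2 x))"] exI[of _ "\<lambda>x. (g1' (\<psi>1 x), g2' (\<psi>2 x))"]) simp
qed

text \<open>Only the first components are moved; making these distinct suffices.\<close>

lemma avoidable_prod_left:
  assumes "avoidable K L X R"
  shows "avoidable K L (prod_metric X Y) R"
  unfolding avoidable_def
proof (intro allI impI)
  fix \<epsilon> :: real and f g
  assume \<epsilon>: "0 < \<epsilon>" and fg: "continuous_map K (mtopology_of (prod_metric X Y)) f \<and> continuous_map L (mtopology_of (prod_metric X Y)) g"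
  have c: "continuous_map K (mtopology_of X) (\<lambda>x. fst (f x))" "continuous_map K (mtopology_of Y) (\<lambda>x. snd (f x))"
      "continuous_map L (mtopology_of X) (\<lambda>x. fst (g x))" "continuous_map L (mtopology_of Y) (\<lambda>x. snd (g x))"
    using fg by (auto simp: continuous_map_pairwise o_def)
  have e: "0 < \<epsilon>/2" using \<epsilon> by simp
  obtain f' g' where 1: "small_homotopic K X (\<epsilon>/2) (\<lambda>x. fst (f x)) f'" "small_homotopic L X (\<epsilon>/2) (\<lambda>x. fst (g x)) g'"
    "\<And>x y. x \<in> topspace K \<Longrightarrow> y \<in> topspace L \<Longrightarrow> R x y \<Longrightarrow> f' x \<noteq> g' y"
    using avoidableE[OF assms e c(1,3)] by blast
  have "small_homotopic K (prod_metric X Y) \<epsilon> f (\<lambda>x. (f' x, snd (f x)))"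
       "small_homotopic L (prod_metric X Y) \<epsilon> g (\<lambda>x. (g' x, snd (g x)))"
    using small_homotopic_pair[OF 1(1) small_homotopic_refl[OF c(2) e]]
      small_homotopic_pair[OF 1(2) small_homotopic_refl[OF c(4) e]] by simp_all
  then show "\<exists>f' g'. small_homotopic K (prod_metric X Y) \<epsilon> f f' \<and> small_homotopic L (prod_metric X Y) \<epsilon> g g' \<and>
           (\<forall>x\<in>topspace K. \<forall>y\<in>topspace L. R x y \<longrightarrow> f' x \<noteq> g' y)"
    using 1(3) by (intro exI[of _ "\<lambda>x. (f' x, snd (f x))"] exI[of _ "\<lambda>x. (g' x, snd (g x))"]) simp
qed

lemma fiberwise_DD_prod_left:
  assumes "metrizable_space X" "metrizable_space Y" "fiberwise_DD m n k X"
  shows "fiberwise_DD m n k (prod_topology X Y)"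
proof -
  obtain mX where mX: "X = mtopology_of mX" using assms(1) by (rule metrizable_obtain_metric)
  obtain mY where mY: "Y = mtopology_of mY" using assms(2) by (rule metrizable_obtain_metric)
  have "fiberwise_DD m n k (mtopology_of (prod_metric mX mY))"
    unfolding fiberwise_DD_iff_avoidable
    by (rule avoidable_prod_left) (rule assms(3)[unfolded mX fiberwise_DD_iff_avoidable])
  then show ?thesis by (simp add: mX mY)
qed

lemma fiberwise_DD_prod_commute:
  assumes "fiberwise_DD m n k (prod_topology X Y)"
  shows "fiberwise_DD m n k (prod_topology Y X)"
  by (rule fiberwise_DD_homeomorphic[OF assms, of _ "\<lambda>(x,y). (y,x)" "\<lambda>(x,y). (y,x)"])
    (auto simp: homeomorphic_maps_def case_prod_unfold continuous_map_paired continuous_map_fst continuous_map_snd)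

subsection \<open>Grids in cubes and the multiplication formulas\<close>

lemma continuous_map_fst2: "continuous_map K (prod_topology A B) f \<Longrightarrow> continuous_map K A (\<lambda>x. fst (f x))"
  by (simp add: continuous_map_pairwise o_def)

lemma continuous_map_snd2: "continuous_map K (prod_topology A B) f \<Longrightarrow> continuous_map K B (\<lambda>x. snd (f x))"
  by (simp add: continuous_map_pairwise o_def)

lemma continuous_map_unit_real: "continuous_map K unit_interval f \<Longrightarrow> continuous_map K euclideanreal f"
  by (simp add: continuous_map_unit_interval)

lemma in_cube_coord: "x \<in> topspace (cube n) \<Longrightarrow> enat i < n \<Longrightarrow> 0 \<le> x i \<and> x i \<le> 1"
  by (auto simp: topspace_cube)

lemma restrict_in_cube:
  "(\<And>i. enat i < n \<Longrightarrow> 0 \<le> g i \<and> g i \<le> 1) \<Longrightarrow> restrict g {i. enat i < n} \<in> topspace (cube n)"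
  by (auto simp: topspace_cube)

lemma continuous_map_restrict_cube:
  assumes "\<And>i. enat i < n \<Longrightarrow> continuous_map K euclideanreal (\<lambda>x. g x i)"
    and "\<And>x i. x \<in> topspace K \<Longrightarrow> enat i < n \<Longrightarrow> 0 \<le> g x i \<and> g x i \<le> 1"
  shows "continuous_map K (cube n) (\<lambda>x. restrict (g x) {i. enat i < n})"
  using assms by (simp add: continuous_map_cube restrict_in_cube)

text \<open>This is \<open>b\<close> clamped to the interval from a - s to a + s: for s \<ge> 0, the
  position at time \<open>s\<close> of a point that travels from \<open>a\<close> towards
  \<open>b\<close> at unit speed and stops on arrival.\<close>

definition move :: "real \<Rightarrow> real \<Rightarrow> real \<Rightarrow> real" where
  "move s a b = max (a - s) (min (a + s) b)"

lemma move_bounds: "0 \<le> a \<Longrightarrow> a \<le> 1 \<Longrightarrow> 0 \<le> b \<Longrightarrow> b \<le> 1 \<Longrightarrow> 0 \<le> s \<Longrightarrow> 0 \<le> move s a b \<and> move s a b \<le> 1"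
  by (auto simp: move_def)

lemma move_0 [simp]: "move 0 a b = a"
  by (auto simp: move_def)

lemma move_reached: "\<bar>a - b\<bar> \<le> s \<Longrightarrow> move s a b = b"
  by (auto simp: move_def)

lemma continuous_map_move:
  "continuous_map K euclideanreal s \<Longrightarrow> continuous_map K euclideanreal a \<Longrightarrow> continuous_map K euclideanreal b \<Longrightarrow>
    continuous_map K euclideanreal (\<lambda>x. move (s x) (a x) (b x))"
  unfolding move_def by (intro continuous_intros)

definition cubemap :: "enat \<Rightarrow> (real \<Rightarrow> real) \<Rightarrow> (nat \<Rightarrow> real) \<Rightarrow> nat \<Rightarrow> real" where
  "cubemap k r y = restrict (\<lambda>i. r (y i)) {i. enat i < k}"

lemma continuous_map_cubemap:
  assumes "continuous_map unit_interval unit_interval r"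
  shows "continuous_map (cube k) (cube k) (cubemap k r)"
proof -
  have "continuous_map (cube k) (cube k) (\<lambda>y. restrict (\<lambda>i. r (y i)) {i. enat i < k})"
  proof (rule continuous_map_restrict_cube)
    fix i assume i: "enat i < k"
    have "continuous_map (cube k) unit_interval (\<lambda>y. y i)"
      unfolding cube_def by (rule continuous_map_product_projection) (use i in auto)
    then have *: "continuous_map (cube k) unit_interval (\<lambda>y. r (y i))"
      by (rule continuous_map_compose2[OF assms])
    then show "continuous_map (cube k) euclideanreal (\<lambda>y. r (y i))" by (rule continuous_map_unit_real)
    show "0 \<le> r (y i) \<and> r (y i) \<le> 1" if "y \<in> topspace (cube k)" for y
      using continuous_map_in_topspace[OF * that] by auto
  qed
  then show ?thesis by (simp add: cubemap_def[abs_def])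
qed

text \<open>One \<open>c\<close> has to serve all maps \<open>r\<close> at once. The target of the
  motion is therefore an independent variable ranging over a second cube, and compactness is applied
  to the product; the Hilbert cube needs no separate treatment, as all coordinates move
  simultaneously.\<close>

lemma small_homotopic_cubemap:
  assumes f: "continuous_map (bicube m k) (mtopology_of X) f" and \<epsilon>: "0 < \<epsilon>"
  obtains c where "0 < c" "\<And>r. continuous_map unit_interval unit_interval r \<Longrightarrow> (\<And>s. 0 \<le> s \<Longrightarrow> s \<le> 1 \<Longrightarrow> \<bar>r s - s\<bar> \<le> c) \<Longrightarrow>
     small_homotopic (bicube m k) X \<epsilon> f (\<lambda>p. f (fst p, cubemap k r (snd p)))"
proof -
  let ?K = "prod_topology (bicube m k) (cube k)"
  let ?P = "prod_topology ?K unit_interval"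
  define q :: "(((nat \<Rightarrow> real) \<times> (nat \<Rightarrow> real)) \<times> (nat \<Rightarrow> real)) \<times> real \<Rightarrow> (nat \<Rightarrow> real) \<times> (nat \<Rightarrow> real)"
    where "q = (\<lambda>w. (fst (fst (fst w)), restrict (\<lambda>i. move (snd w) (snd (fst (fst w)) i) (snd (fst w) i)) {i. enat i < k}))"
  have id: "continuous_map ?P ?P (\<lambda>w. w)" by simp
  have q: "continuous_map ?P (bicube m k) q"
    unfolding q_def continuous_map_paired
  proof (intro conjI continuous_map_restrict_cube continuous_map_move)
    show "continuous_map ?P (cube m) (\<lambda>w. fst (fst (fst w)))"
      by (rule continuous_map_fst2[OF continuous_map_fst2[OF continuous_map_fst2[OF id]]])
    show "continuous_map ?P euclideanreal snd"
      using continuous_map_unit_real[OF continuous_map_snd2[OF id]] .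
    fix i assume i: "enat i < k"
    show "continuous_map ?P euclideanreal (\<lambda>w. snd (fst (fst w)) i)"
      by (rule continuous_map_cube_coord[OF continuous_map_snd2[OF continuous_map_fst2[OF continuous_map_fst2[OF id]]] i])
    show "continuous_map ?P euclideanreal (\<lambda>w. snd (fst w) i)"
      by (rule continuous_map_cube_coord[OF continuous_map_snd2[OF continuous_map_fst2[OF id]] i])
    show "0 \<le> move (snd w) (snd (fst (fst w)) i) (snd (fst w) i)" "move (snd w) (snd (fst (fst w)) i) (snd (fst w) i) \<le> 1"
      if "w \<in> topspace ?P" for w
      using move_bounds in_cube_coord[OF _ i] that by (auto simp: mem_Times_iff)
  qed
  have q0: "q ((p, y), 0) = p" if "p \<in> topspace (bicube m k)" for p y
    using that by (cases p) (auto simp: q_def topspace_cube)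
  have fp: "continuous_map ?P (mtopology_of X) (\<lambda>w. f (q w))"
    by (rule continuous_map_compose2[OF f q])
  have fS: "f p \<in> mspace X" if "p \<in> topspace (bicube m k)" for p
    using continuous_map_in_topspace[OF f that] by simp
  obtain c where c: "0 < c" "c \<le> 1"
    and cs: "\<And>w s. w \<in> topspace ?K \<Longrightarrow> 0 \<le> s \<Longrightarrow> s \<le> c \<Longrightarrow> mdist X (f (fst w)) (f (q (w, s))) < \<epsilon>"
  proof (rule compact_uniformly_small)
    show "compact_space ?K" by (simp add: compact_space_prod_topology compact_cube)
    show "continuous_map ?P euclideanreal (\<lambda>z. mdist X (f (fst (fst z))) (f (q z)))"
      by (rule continuous_map_mdist[OF continuous_map_compose2[OF f continuous_map_fst2[OF continuous_map_fst2[OF id]]] fp])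
    show "mdist X (f (fst (fst (w, 0)))) (f (q (w, 0))) < \<epsilon>" if "w \<in> topspace ?K" for w
    proof (cases w)
      case (Pair p y)
      then have "p \<in> topspace (bicube m k)" using that by auto
      then show ?thesis using Pair q0 mdist_self[OF fS] \<epsilon> by simp
    qed
  qed auto
  show ?thesis
  proof (rule that[OF c(1)])
    fix r :: "real \<Rightarrow> real"
    assume r: "continuous_map unit_interval unit_interval r" and rc: "\<And>s. 0 \<le> s \<Longrightarrow> s \<le> 1 \<Longrightarrow> \<bar>r s - s\<bar> \<le> c"
    let ?Q = "prod_topology (bicube m k) unit_interval"
    have idQ: "continuous_map ?Q ?Q (\<lambda>w. w)" by simp
    \<comment> \<open>The motion lasts until time \<open>c\<close>, when every coordinate has
      arrived because \<open>r\<close> displaces it by at most \<open>c\<close>.\<close>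
    define h where "h = (\<lambda>w. f (q ((fst w, cubemap k r (snd (fst w))), c * snd w)))"
    have "0 \<le> c * snd w \<and> c * snd w \<le> 1" if "w \<in> topspace ?Q" for w
      using that c by (auto intro: mult_le_one)
    moreover have "continuous_map ?Q euclideanreal (\<lambda>w. c * snd w)"
      by (intro continuous_intros continuous_map_unit_real[OF continuous_map_snd2[OF idQ]])
    ultimately have "continuous_map ?Q unit_interval (\<lambda>w. c * snd w)"
      by (simp only: continuous_map_unit_interval) simp
    moreover have "continuous_map ?Q (cube k) (\<lambda>w. cubemap k r (snd (fst w)))"
      by (rule continuous_map_compose2[OF continuous_map_cubemap[OF r] continuous_map_snd2[OF continuous_map_fst2[OF idQ]]])
    ultimately have "continuous_map ?Q ?P (\<lambda>w. ((fst w, cubemap k r (snd (fst w))), c * snd w))"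
      by (simp only: continuous_map_paired continuous_map_fst)
    then have hc: "continuous_map ?Q (mtopology_of X) h"
      unfolding h_def by (rule continuous_map_compose2[OF fp])
    have h0: "h (p, 0) = f p" if "p \<in> topspace (bicube m k)" for p
      using q0[OF that] by (simp add: h_def)
    have h1: "h (p, 1) = f (fst p, cubemap k r (snd p))" if "p \<in> topspace (bicube m k)" for p
    proof -
      have "move c (snd p i) (r (snd p i)) = r (snd p i)" if "enat i < k" for i
        using rc[of "snd p i"] in_cube_coord[OF _ that, of "snd p"] \<open>p \<in> topspace (bicube m k)\<close>
        by (intro move_reached) (auto simp: mem_Times_iff abs_minus_commute)
      then have "restrict (\<lambda>i. move c (snd p i) (cubemap k r (snd p) i)) {i. enat i < k} = cubemap k r (snd p)"
        by (auto simp: cubemap_def)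
      then show ?thesis by (simp add: h_def q_def)
    qed
    have "mdist X (f p) (h (p, t)) < \<epsilon>" if p: "p \<in> topspace (bicube m k)" and t: "t \<in> {0..1}" for p t
    proof -
      have "(p, cubemap k r (snd p)) \<in> topspace ?K"
        using p continuous_map_in_topspace[OF continuous_map_cubemap[OF r]] by (auto simp: mem_Times_iff)
      then show ?thesis
        using cs[of "(p, cubemap k r (snd p))" "c * t"] t c by (simp add: h_def mult_left_le)
    qed
    then show "small_homotopic (bicube m k) X \<epsilon> f (\<lambda>p. f (fst p, cubemap k r (snd p)))"
      unfolding small_homotopic_def using hc h0 h1 by blast
  qed
qed

section \<open>Closed relations, subcubes and skeleta\<close>

lemma closed_rel_conj:
  assumes "closed_rel K L R" "closed_rel K L S"
  shows "closed_rel K L (\<lambda>x y. R x y \<and> S x y)"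
proof -
  have "{z \<in> topspace (prod_topology K L). R (fst z) (snd z) \<and> S (fst z) (snd z)} =
    {z \<in> topspace (prod_topology K L). R (fst z) (snd z)} \<inter> {z \<in> topspace (prod_topology K L). S (fst z) (snd z)}"
    by auto
  then show ?thesis using assms unfolding closed_rel_def by (simp only: closedin_Int)
qed

lemma closed_rel_eq:
  assumes "Hausdorff_space Z" "continuous_map K Z a" "continuous_map L Z b"
  shows "closed_rel K L (\<lambda>x y. a x = b y)"
  unfolding closed_rel_def
  by (rule closedin_continuous_maps_eq[OF assms(1)])
    (rule continuous_map_compose2[OF assms(2) continuous_map_fst] continuous_map_compose2[OF assms(3) continuous_map_snd])+

lemma closed_rel_zero:
  assumes "continuous_map K euclideanreal \<delta>"
  shows "closed_rel K L (\<lambda>x y. \<delta> x = 0)" "closed_rel L K (\<lambda>x y. \<delta> y = 0)"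
  unfolding closed_rel_def
  by (rule closedin_continuous_maps_eq[OF Hausdorff_space_euclidean], rule continuous_map_compose2[OF assms],
      rule continuous_map_fst continuous_map_snd, simp)+

lemma closed_rel_finite_UN:
  assumes "finite I" "\<And>i. i \<in> I \<Longrightarrow> closed_rel K L (R i)"
  shows "closed_rel K L (\<lambda>x y. \<exists>i\<in>I. R i x y)"
proof -
  have "{z \<in> topspace (prod_topology K L). \<exists>i\<in>I. R i (fst z) (snd z)} =
    (\<Union>i\<in>I. {z \<in> topspace (prod_topology K L). R i (fst z) (snd z)})"
    by auto
  then show ?thesis using assms unfolding closed_rel_def by (simp del: topspace_prod_topology) (blast intro: closedin_Union)
qed

text \<open>Each pair of indices contributes one relation, avoidable by pinching and closed as an
  intersection of zero sets with an equation in a Hausdorff cube. Closedness of the union is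
  recorded because the second formula unites two such relations once more.\<close>

lemma avoidable_pinching_UN:
  assumes "compact_space K" "compact_space L" "finite I" "finite J"
    and DD: "fiberwise_DD m n k (mtopology_of X)"
    and PK: "\<And>i. i \<in> I \<Longrightarrow> pinching K (bicube m n) (e i) (\<delta> i)"
    and PL: "\<And>j. j \<in> J \<Longrightarrow> pinching L (bicube m k) (e' j) (\<delta>' j)"
  shows "\<exists>R. avoidable K L X R \<and> closed_rel K L R \<and>
    (\<forall>i\<in>I. \<forall>j\<in>J. \<forall>x y. \<delta> i x = 0 \<longrightarrow> \<delta>' j y = 0 \<longrightarrow> fst (e i x) = fst (e' j y) \<longrightarrow> R x y)"
proof -
  let ?R = "\<lambda>ij x y. \<delta> (fst ij) x = 0 \<and> \<delta>' (snd ij) y = 0 \<and> fst (e (fst ij) x) = fst (e' (snd ij) y)"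
  have p: "pinching K (bicube m n) (e (fst ij)) (\<delta> (fst ij))" "pinching L (bicube m k) (e' (snd ij)) (\<delta>' (snd ij))"
    if "ij \<in> I \<times> J" for ij
    using that PK PL by auto
  have cl: "closed_rel K L (?R ij)" if "ij \<in> I \<times> J" for ij
    using p[OF that] unfolding pinching_def
    by (elim conjE) (intro closed_rel_conj closed_rel_zero closed_rel_eq[of "cube m"] Hausdorff_cube continuous_map_fst2)
  have "avoidable K L X (\<lambda>x y. \<exists>ij\<in>I \<times> J. ?R ij x y)"
    using assms(3,4) avoidable_pinching[OF assms(1,2) p DD[unfolded fiberwise_DD_iff_avoidable]] cl
    by (intro avoidable_finite_UN[OF _ assms(1,2)]) auto
  moreover have "closed_rel K L (\<lambda>x y. \<exists>ij\<in>I \<times> J. ?R ij x y)"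
    using assms(3,4) cl by (intro closed_rel_finite_UN) auto
  ultimately show ?thesis
    by (intro exI[of _ "\<lambda>x y. \<exists>ij\<in>I \<times> J. ?R ij x y"]) auto
qed

text \<open>The zero set of \<delta> is the subcube on which the coordinates in \<open>S\<close>
  have the values \<open>v\<close>, and \<delta> is the l1-distance from it. Each pinned coordinate
  is at distance at most \<delta> from its value, so moving all of them at unit speed is finished by
  time \<delta>; \<open>b\<close> renumbers the free coordinates.\<close>

lemma pinching_subcube:
  assumes S: "S \<subseteq> {i. enat i < n}" "finite S" and v: "\<And>i. i \<in> S \<Longrightarrow> 0 \<le> v i \<and> v i \<le> 1"
    and b: "bij_betw b {i. enat i < n'} ({i. enat i < n} - S)"
  shows "pinching (bicube m n) (bicube m n') (\<lambda>p. (fst p, restrict (\<lambda>i. snd p (b i)) {i. enat i < n'}))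
     (\<lambda>p. \<Sum>i\<in>S. \<bar>snd p i - v i\<bar>)"
proof -
  let ?K = "bicube m n" and ?K' = "bicube m n'" and ?I = "{i. enat i < n}" and ?I' = "{i. enat i < n'}"
  let ?P = "prod_topology ?K unit_interval"
  let ?e = "\<lambda>p. (fst p, restrict (\<lambda>i. snd p (b i)) ?I')"
  let ?\<delta> = "\<lambda>p. \<Sum>i\<in>S. \<bar>snd p i - v i\<bar>"
  define b' where "b' = inv_into ?I' b"
  define r :: "(nat \<Rightarrow> real) \<times> (nat \<Rightarrow> real) \<Rightarrow> (nat \<Rightarrow> real) \<times> (nat \<Rightarrow> real)"
    where "r = (\<lambda>p. (fst p, restrict (\<lambda>i. if i \<in> S then v i else snd p (b' i)) ?I))"
  define q :: "((nat \<Rightarrow> real) \<times> (nat \<Rightarrow> real)) \<times> real \<Rightarrow> (nat \<Rightarrow> real) \<times> (nat \<Rightarrow> real)"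
    where "q = (\<lambda>w. (fst (fst w), restrict (\<lambda>i. if i \<in> S then move (snd w) (snd (fst w) i) (v i) else snd (fst w) i) ?I))"
  have bI: "enat (b i) < n" if "enat i < n'" for i
    using b that by (auto simp: bij_betw_def)
  have b'I: "enat (b' i) < n'" "b (b' i) = i" if "enat i < n" "i \<notin> S" for i
  proof -
    have "i \<in> b ` ?I'" using b that by (auto simp: bij_betw_def)
    then show "enat (b' i) < n'" "b (b' i) = i"
      unfolding b'_def using inv_into_into[of i b ?I'] f_inv_into_f[of i b ?I'] by auto
  qed
  have coord: "continuous_map (bicube m n) euclideanreal (\<lambda>p. snd p i)" if "enat i < n" for i n
    by (rule continuous_map_cube_coord[OF continuous_map_snd that])
  have e: "continuous_map ?K ?K' ?e"
    unfolding continuous_map_paired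
    by (intro conjI continuous_map_restrict_cube coord continuous_map_fst)
      (use in_cube_coord bI in \<open>auto simp: mem_Times_iff\<close>)
  have \<delta>: "continuous_map ?K euclideanreal ?\<delta>"
    using S by (intro continuous_intros coord) auto
  have r: "continuous_map ?K' ?K r"
    unfolding r_def continuous_map_paired
    by (intro conjI continuous_map_restrict_cube coord continuous_map_fst continuous_map_if)
      (use in_cube_coord[of _ n'] b'I v in \<open>auto simp: mem_Times_iff\<close>)
  have id: "continuous_map ?P ?P (\<lambda>w. w)" by simp
  have q: "continuous_map ?P ?K q"
    unfolding q_def continuous_map_paired
  proof (intro conjI continuous_map_restrict_cube continuous_map_if continuous_map_move continuous_map_canonical_const)
    show "continuous_map ?P (cube m) (\<lambda>w. fst (fst w))"
      by (rule continuous_map_fst2[OF continuous_map_fst2[OF id]])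
    show "continuous_map ?P euclideanreal snd"
      using continuous_map_unit_real[OF continuous_map_snd2[OF id]] .
    fix i assume i: "enat i < n"
    show "continuous_map ?P euclideanreal (\<lambda>w. snd (fst w) i)" 
         "continuous_map ?P euclideanreal (\<lambda>w. snd (fst w) i)"
      by (rule continuous_map_cube_coord[OF continuous_map_snd2[OF continuous_map_fst2[OF id]] i])+
    fix w assume w: "w \<in> topspace ?P"
    have "0 \<le> snd (fst w) i \<and> snd (fst w) i \<le> 1" "0 \<le> snd w" using in_cube_coord[OF _ i] w by (auto simp: mem_Times_iff)
    then show "0 \<le> (if i \<in> S then move (snd w) (snd (fst w) i) (v i) else snd (fst w) i)"
      "(if i \<in> S then move (snd w) (snd (fst w) i) (v i) else snd (fst w) i) \<le> 1"
      using move_bounds[of "snd (fst w) i" "v i" "snd w"] v[of i] by auto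
  qed
  have q0: "q (p, 0) = p" if "p \<in> topspace ?K" for p
    using that by (cases p) (auto simp: q_def topspace_cube fun_eq_iff restrict_def PiE_def extensional_def)
  have q1: "q (p, s) = r (?e p)" if p: "p \<in> topspace ?K" and "?\<delta> p \<le> s" for p s
  proof -
    have "move s (snd p i) (v i) = v i" if "i \<in> S" for i
    proof (rule move_reached)
      have "\<bar>snd p i - v i\<bar> \<le> ?\<delta> p"
        by (rule member_le_sum) (use S that in auto)
      then show "\<bar>snd p i - v i\<bar> \<le> s" using \<open>?\<delta> p \<le> s\<close> by simp
    qed
    then show ?thesis by (auto simp: q_def r_def restrict_def fun_eq_iff b'I)
  qed
  show ?thesis
    unfolding pinching_def
    by (intro conjI e \<delta> exI[of _ r] exI[of _ q] r q) (auto simp: q0 q1 intro: sum_nonneg)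
qed

text \<open>Thick points form the skeleton of codimension \<open>s\<close> of the grid. The witness
  has exactly \<open>s\<close> elements, so that the remaining coordinates span a cube of known
  dimension.\<close>

definition thick :: "enat \<Rightarrow> nat \<Rightarrow> real set \<Rightarrow> (nat \<Rightarrow> real) \<Rightarrow> bool" where
  "thick n s G x \<longleftrightarrow> (\<exists>S. S \<subseteq> {i. enat i < n} \<and> finite S \<and> card S = s \<and> (\<forall>i\<in>S. x i \<in> G))"

lemma thick_0 [simp]: "thick n 0 G x"
  unfolding thick_def by (rule exI[of _ "{}"]) auto

lemma subcube_bij:
  assumes "S \<subseteq> {i. enat i < n}" "finite S" "n = n' + enat (card S)" "card S = 0 \<or> n \<noteq> \<infinity>"
  shows "\<exists>b. bij_betw b {i. enat i < n'} ({i. enat i < n} - S)"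
proof (cases "card S = 0")
  case True
  then have "S = {}" "n' = n" using assms by (auto simp: zero_enat_def[symmetric])
  then show ?thesis by (intro exI[of _ id]) simp
next
  case False
  then obtain N N' where N: "n = enat N" "n' = enat N'"
    using assms by (cases n; cases n') auto
  then have "N = N' + card S" using assms by simp
  then have "card {i. enat i < n'} = card ({i. enat i < n} - S)"
    using assms N by (simp add: card_Diff_subset lessThan_def[symmetric])
  then show ?thesis
    using N by (intro finite_same_card_bij) (auto simp: lessThan_def[symmetric])
qed

lemma avoidable_thick:
  assumes DD: "fiberwise_DD m n' k' (mtopology_of X)" and G: "finite G" "G \<subseteq> {0..1}"
    and n: "n = n' + enat s" "s = 0 \<or> n \<noteq> \<infinity>" and k: "k = k' + enat t" "t = 0 \<or> k \<noteq> \<infinity>"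
  shows "\<exists>R. avoidable (bicube m n) (bicube m k) X R \<and> closed_rel (bicube m n) (bicube m k) R \<and>
     (\<forall>p q. fst p = fst q \<and> thick n s G (snd p) \<and> thick k t G (snd q) \<longrightarrow> R p q)"
proof -
  \<comment> \<open>An index is a set of pinned coordinates together with their grid values; taking
    the values as extensional functions keeps the family finite.\<close>
  define \<I> where "\<I> = (\<lambda>n s. Sigma {S. S \<subseteq> {i. enat i < n} \<and> finite S \<and> card S = s} (\<lambda>S. S \<rightarrow>\<^sub>E G))"
  have fin: "finite (\<I> n s)" if ns: "s = 0 \<or> n \<noteq> \<infinity>" for n s
    unfolding \<I>_def
  proof (rule finite_SigmaI)
    show "finite {S. S \<subseteq> {i. enat i < n} \<and> finite S \<and> card S = s}"
    proof (cases "s = 0")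
      case True
      then have "{S. S \<subseteq> {i. enat i < n} \<and> finite S \<and> card S = s} \<subseteq> {{}}" by auto
      then show ?thesis using finite_subset by blast
    next
      case False
      then obtain N where "n = enat N" using ns by auto
      then have "finite {i. enat i < n}" by (simp add: lessThan_def[symmetric])
      then show ?thesis by simp
    qed
    show "finite (S \<rightarrow>\<^sub>E G)" if "S \<in> {S. S \<subseteq> {i. enat i < n} \<and> finite S \<and> card S = s}" for S
      using that G by (intro finite_PiE) auto
  qed
  define b where "b = (\<lambda>n n' S. SOME b. bij_betw b {i. enat i < n'} ({i. enat i < n} - S))"
  define e where "e = (\<lambda>n n' (i :: nat set \<times> (nat \<Rightarrow> real)) (p :: (nat \<Rightarrow> real) \<times> (nat \<Rightarrow> real)).
     (fst p, restrict (\<lambda>j. snd p (b n n' (fst i) j)) {j. enat j < n'}))"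
  define \<delta> where "\<delta> = (\<lambda>(i :: nat set \<times> (nat \<Rightarrow> real)) (p :: (nat \<Rightarrow> real) \<times> (nat \<Rightarrow> real)). \<Sum>j\<in>fst i. \<bar>snd p j - snd i j\<bar>)"
  have pinch: "pinching (bicube m n) (bicube m n') (e n n' i) (\<delta> i)"
    if "n = n' + enat s" "s = 0 \<or> n \<noteq> \<infinity>" "i \<in> \<I> n s" for i n n' s
  proof -
    obtain S v where i: "i = (S, v)" by (cases i)
    have S: "S \<subseteq> {i. enat i < n}" "finite S" "card S = s" "v \<in> S \<rightarrow>\<^sub>E G"
      using that i by (auto simp: \<I>_def)
    then have "\<exists>b. bij_betw b {i. enat i < n'} ({i. enat i < n} - S)"
      using that by (intro subcube_bij) auto
    then have "bij_betw (b n n' S) {i. enat i < n'} ({i. enat i < n} - S)"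
      unfolding b_def by (rule someI_ex)
    moreover have "0 \<le> v i \<and> v i \<le> 1" if "i \<in> S" for i
      using PiE_mem[OF S(4) that] G by auto
    ultimately show ?thesis
      using pinching_subcube[OF S(1,2), of v "b n n' S" n' m] by (simp add: e_def \<delta>_def i)
  qed
  have "\<exists>R. avoidable (bicube m n) (bicube m k) X R \<and> closed_rel (bicube m n) (bicube m k) R \<and>
      (\<forall>i\<in>\<I> n s. \<forall>j\<in>\<I> k t. \<forall>x y. \<delta> i x = 0 \<longrightarrow> \<delta> j y = 0 \<longrightarrow> fst (e n n' i x) = fst (e k k' j y) \<longrightarrow> R x y)"
    by (rule avoidable_pinching_UN[OF compact_bicube compact_bicube fin[OF n(2)] fin[OF k(2)] DD pinch[OF n] pinch[OF k]])
  then obtain R where R: "avoidable (bicube m n) (bicube m k) X R" "closed_rel (bicube m n) (bicube m k) R"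
    and R': "\<forall>i\<in>\<I> n s. \<forall>j\<in>\<I> k t. \<forall>x y. \<delta> i x = 0 \<longrightarrow> \<delta> j y = 0 \<longrightarrow> fst (e n n' i x) = fst (e k k' j y) \<longrightarrow> R x y"
    by (elim exE conjE)
  have "R p q" if "fst p = fst q \<and> thick n s G (snd p) \<and> thick k t G (snd q)" for p q
  proof -
    have eq: "fst p = fst q" and "thick n s G (snd p)" "thick k t G (snd q)"
      using that by auto
    then obtain S T where S: "S \<subseteq> {i. enat i < n}" "finite S" "card S = s" "\<forall>i\<in>S. snd p i \<in> G"
      and T: "T \<subseteq> {i. enat i < k}" "finite T" "card T = t" "\<forall>i\<in>T. snd q i \<in> G"
      unfolding thick_def by (elim exE conjE)
    \<comment> \<open>The pinned values are the coordinates of the point itself, which makes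
      \<delta> vanish.\<close>
    have "(S, restrict (snd p) S) \<in> \<I> n s" "(T, restrict (snd q) T) \<in> \<I> k t"
      using S T by (auto simp: \<I>_def)
    moreover have "\<delta> (S, restrict (snd p) S) p = 0" "\<delta> (T, restrict (snd q) T) q = 0"
      by (auto simp: \<delta>_def)
    ultimately show ?thesis
      by (rule R'[rule_format]) (simp add: e_def eq)
  qed
  then show ?thesis using R by (intro exI[of _ R]) simp
qed

section \<open>Self-maps of the interval near the identity\<close>

definition staircase :: "(real \<Rightarrow> real) \<Rightarrow> nat \<Rightarrow> real \<Rightarrow> real" where
  "staircase q N s = (\<Sum>j<N. q (real N * s - real j)) / real N"

text \<open>In cell \<open>i\<close> all earlier summands have reached 1 and all later ones are
  still 0. Writing the map as a sum makes its continuity immediate, without gluing.\<close>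

lemma staircase_eq:
  assumes "\<And>u. u \<le> 0 \<Longrightarrow> q u = 0" "\<And>u. 1 \<le> u \<Longrightarrow> q u = 1"
    and "i < N" "0 \<le> u" "u \<le> 1" "real N * s = real i + u"
  shows "staircase q N s = (real i + q u) / real N"
proof -
  have N: "{..<N} = {..<i} \<union> {i} \<union> {i<..<N}" using assms(3) by auto
  have "(\<Sum>j<N. q (real N * s - real j)) = (\<Sum>j<i. q (real N * s - real j)) + q (real N * s - real i) + (\<Sum>j\<in>{i<..<N}. q (real N * s - real j))"
    unfolding N by (subst sum.union_disjoint; auto)+
  also have "(\<Sum>j<i. q (real N * s - real j)) = (\<Sum>j<i. 1)"
    by (intro sum.cong refl assms(2)) (use assms in \<open>auto simp: field_simps\<close>)
  also have "(\<Sum>j\<in>{i<..<N}. q (real N * s - real j)) = (\<Sum>j\<in>{i<..<N}. 0)"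
    by (intro sum.cong refl assms(1)) (use assms in \<open>auto simp: field_simps\<close>)
  finally show ?thesis using assms(6) by (simp add: staircase_def)
qed

lemma unit_interval_cell:
  fixes s :: real
  assumes "0 \<le> s" "s \<le> 1" "0 < N"
  obtains i u where "i < N" "0 \<le> u" "u \<le> 1" "real N * s = real i + u"
proof (cases "s = 1")
  case True
  \<comment> \<open>The right endpoint is assigned to the last cell, with u = 1.\<close>
  then show ?thesis using assms that[of "N - 1" 1] by (simp add: of_nat_diff)
next
  case False
  define i where "i = nat \<lfloor>real N * s\<rfloor>"
  have "real N * s < real N" using False assms by simp
  moreover have f: "real i \<le> real N * s" "real N * s < real i + 1"
    unfolding i_def using assms by simp_all
  ultimately have "i < N" by linarith
  then show ?thesis using that[of i "real N * s - real i"] f by simp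
qed

lemma grid_maps:
  assumes "0 < (c::real)"
  obtains r1 r2 and G :: "real set" where "finite G" "G \<subseteq> {0..1}"
    "continuous_map unit_interval unit_interval r1" "continuous_map unit_interval unit_interval r2"
    "\<And>s. 0 \<le> s \<Longrightarrow> s \<le> 1 \<Longrightarrow> \<bar>r1 s - s\<bar> \<le> c" "\<And>s. 0 \<le> s \<Longrightarrow> s \<le> 1 \<Longrightarrow> \<bar>r2 s - s\<bar> \<le> c"
    "\<And>s. 0 \<le> s \<Longrightarrow> s \<le> 1 \<Longrightarrow> r1 s \<in> G \<or> r2 s \<in> G"
proof -
  obtain N where N: "0 < N" "inverse (real N) < c"
    using reals_Archimedean[OF assms] by blast
  \<comment> \<open>\<open>q1\<close> is constant near the integers, \<open>q2\<close> near the half-integers, so one of them always hits the grid.\<close>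
  define q1 :: "real \<Rightarrow> real" where "q1 u = max 0 (min 1 (2 * u - 1/2))" for u
  define q2 :: "real \<Rightarrow> real" where "q2 u = max 0 (min (1/2) (2 * u)) + max 0 (min (1/2) (2 * u - 3/2))" for u
  \<comment> \<open>Nodes and midpoints of the cells: the plateau values of the two
    staircases.\<close>
  define G where "G = ((\<lambda>i. real i / real N) ` {..N}) \<union> ((\<lambda>i. (real i + 1/2) / real N) ` {..<N})"
  have q: "q u = 0" if "u \<le> 0" "q = q1 \<or> q = q2" for u q using that by (auto simp: q1_def q2_def)
  have q': "q u = 1" if "1 \<le> u" "q = q1 \<or> q = q2" for u q using that by (auto simp: q1_def q2_def)
  have q01: "0 \<le> q u \<and> q u \<le> 1" if "q = q1 \<or> q = q2" for u q using that by (auto simp: q1_def q2_def)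
  have main: "staircase q N s \<in> {0..1}" "\<bar>staircase q N s - s\<bar> \<le> c" if qq: "q = q1 \<or> q = q2" and s: "0 \<le> s" "s \<le> 1" for q s
  proof -
    obtain i u where iu: "i < N" "0 \<le> u" "u \<le> 1" "real N * s = real i + u" using unit_interval_cell[OF s N(1)] .
    have st: "staircase q N s = (real i + q u) / real N" by (rule staircase_eq) (use iu q q' qq in auto)
    have "real i + 1 \<le> real N" using iu by simp
    then show "staircase q N s \<in> {0..1}" using q01[OF qq, of u] N by (simp add: st)
    have "staircase q N s - s = (q u - u) / real N"
      unfolding st using iu N by (simp add: field_simps)
    also have "\<bar>\<dots>\<bar> = \<bar>q u - u\<bar> / real N" by simp
    also have "\<dots> \<le> 1 / real N"
      by (rule divide_right_mono) (use q01[OF qq, of u] iu in linarith, simp)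
    also have "\<dots> = inverse (real N)" by (simp add: inverse_eq_divide)
    finally show "\<bar>staircase q N s - s\<bar> \<le> c" using N by simp
  qed
  have cont: "continuous_map unit_interval unit_interval (staircase q N)" if "q = q1 \<or> q = q2" for q
  proof -
    have "continuous_on UNIV q1" "continuous_on UNIV q2"
      unfolding q1_def[abs_def] q2_def[abs_def] by (intro continuous_intros)+
    then have qc: "continuous_on UNIV q" using that by auto
    have "continuous_on {0..1} (staircase q N)"
      unfolding staircase_def[abs_def] divide_inverse
      by (intro continuous_intros continuous_on_compose2[OF qc]) auto
    then show ?thesis using main(1)[OF that] by (auto simp: continuous_map_in_subtopology)
  qed
  have "staircase q1 N s \<in> G \<or> staircase q2 N s \<in> G" if s: "0 \<le> s" "s \<le> 1" for s
  proof -
    obtain i u where iu: "i < N" "0 \<le> u" "u \<le> 1" "real N * s = real i + u" using unit_interval_cell[OF s N(1)] .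
    have st: "staircase q N s = (real i + q u) / real N" if "q = q1 \<or> q = q2" for q
      by (rule staircase_eq) (use iu q q' that in auto)
    \<comment> \<open>\<open>q1\<close> is 0 up to 1/4 and 1 from 3/4 on, while \<open>q2\<close> is
      1/2 in between; the closed plateaus meet at the thresholds, so no point escapes.\<close>
    consider "u \<le> 1/4" | "3/4 \<le> u" | "1/4 \<le> u" "u \<le> 3/4" by linarith
    then show ?thesis
    proof cases
      case 1
      then have "q1 u = 0" by (auto simp: q1_def)
      then have "staircase q1 N s = real i / real N" using st[of q1] by simp
      then show ?thesis using iu by (auto simp: G_def)
    next
      case 2
      then have "q1 u = 1" by (auto simp: q1_def)
      then have "staircase q1 N s = real (Suc i) / real N" using st[of q1] by (simp add: add.commute)
      moreover have "Suc i \<in> {..N}" using iu by simp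
      ultimately show ?thesis unfolding G_def by blast
    next
      case 3
      then have "q2 u = 1/2" by (auto simp: q2_def)
      then have "staircase q2 N s = (real i + 1/2) / real N" using st[of q2] by simp
      then show ?thesis using iu by (auto simp: G_def)
    qed
  qed
  note inG = this
  have G: "finite G" "G \<subseteq> {0..1}"
  proof -
    have "real i / real N \<in> {0..1}" if "i \<le> N" for i using that N by simp
    moreover have "(real i + 1/2) / real N \<in> {0..1}" if "i < N" for i
    proof -
      have "real i + 1 \<le> real N" using that by simp
      then show ?thesis by simp
    qed
    ultimately show "G \<subseteq> {0..1}" unfolding G_def by blast
  qed (simp add: G_def)
  show ?thesis
    by (rule that[OF G cont[of q1] cont[of q2] main(2)[of q1] main(2)[of q2] inG]) simp_all
qed

text \<open>The indices sent into \<open>G\<close> by \<open>r1\<close> and those sent there by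
  \<open>r2\<close> cover all a + b + 1 indices, so there are at least b + 1 of the former or a + 1
  of the latter.\<close>

lemma thick_dichotomy:
  assumes x: "x \<in> topspace (cube n)" and n: "n = enat (a + b + 1)"
    and r: "\<And>s. 0 \<le> s \<Longrightarrow> s \<le> 1 \<Longrightarrow> r1 s \<in> G \<or> r2 s \<in> G"
  shows "thick n (b + 1) G (cubemap n r1 x) \<or> thick n (a + 1) G (cubemap n r2 x)"
proof -
  define A where "A = {i. i < a + b + 1 \<and> r1 (x i) \<in> G}"
  define B where "B = {i. i < a + b + 1 \<and> r2 (x i) \<in> G}"
  have fin: "finite A" "finite B" by (auto simp: A_def B_def)
  have "{..<a + b + 1} \<subseteq> A \<union> B"
    using r in_cube_coord[OF x] n by (auto simp: A_def B_def)
  then have "a + b + 1 \<le> card (A \<union> B)"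
    using card_mono[of "A \<union> B" "{..<a + b + 1}"] fin by simp
  then have "a + b + 1 \<le> card A + card B" using card_Un_le[of A B] by linarith
  then consider "b + 1 \<le> card A" | "a + 1 \<le> card B" by linarith
  then show ?thesis
  proof cases
    case 1
    then obtain S where "S \<subseteq> A" "card S = b + 1" "finite S" using obtain_subset_with_card_n by metis
    then have "thick n (b + 1) G (cubemap n r1 x)"
      unfolding thick_def by (intro exI[of _ S]) (auto simp: A_def n cubemap_def)
    then show ?thesis ..
  next
    case 2
    then obtain S where "S \<subseteq> B" "card S = a + 1" "finite S" using obtain_subset_with_card_n by metis
    then have "thick n (a + 1) G (cubemap n r2 x)"
      unfolding thick_def by (intro exI[of _ S]) (auto simp: B_def n cubemap_def)
    then show ?thesis ..
  qed
qed

text \<open>This leaves only the combinatorics of grid coordinates to the two formulas.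
  \<open>X\<close> sees both points through \<open>r1\<close> and \<open>Y\<close> sees them through
  \<open>r2\<close>. Avoidability is required for every finite grid, since the grid is fixed after
  the maps.\<close>

lemma product_by_grids:
  assumes X: "\<And>G. finite G \<Longrightarrow> G \<subseteq> {0..1} \<Longrightarrow> avoidable (bicube m n) (bicube m k) X (\<lambda>p q. fst p = fst q \<and> A1 G (snd p) (snd q))"
    and Y: "\<And>G. finite G \<Longrightarrow> G \<subseteq> {0..1} \<Longrightarrow> avoidable (bicube m n) (bicube m k) Y (\<lambda>p q. fst p = fst q \<and> A2 G (snd p) (snd q))"
    and A: "\<And>G r1 r2 x y. (\<And>s. 0 \<le> s \<Longrightarrow> s \<le> 1 \<Longrightarrow> r1 s \<in> G \<or> r2 s \<in> G) \<Longrightarrow> x \<in> topspace (cube n) \<Longrightarrow> y \<in> topspace (cube k) \<Longrightarrow>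
        A1 G (cubemap n r1 x) (cubemap k r1 y) \<or> A2 G (cubemap n r2 x) (cubemap k r2 y)"
  shows "fiberwise_DD m n k (prod_topology (mtopology_of X) (mtopology_of Y))"
proof -
  have "avoidable (bicube m n) (bicube m k) (prod_metric X Y) (\<lambda>p q. fst p = fst q)"
  proof (rule avoidable_prod)
    fix \<epsilon> :: real and f1 f2 g1 g2
    assume \<epsilon>: "0 < \<epsilon>" and f1: "continuous_map (bicube m n) (mtopology_of X) f1" and f2: "continuous_map (bicube m n) (mtopology_of Y) f2"
      and g1: "continuous_map (bicube m k) (mtopology_of X) g1" and g2: "continuous_map (bicube m k) (mtopology_of Y) g2"
    obtain c1 where c1: "0 < c1" "\<And>r. continuous_map unit_interval unit_interval r \<Longrightarrow> (\<And>s. 0 \<le> s \<Longrightarrow> s \<le> 1 \<Longrightarrow> \<bar>r s - s\<bar> \<le> c1) \<Longrightarrow>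
     small_homotopic (bicube m n) X \<epsilon> f1 (\<lambda>p. f1 (fst p, cubemap n r (snd p)))"
      by (rule small_homotopic_cubemap[OF f1 \<epsilon>], rule that) blast+
    obtain c2 where c2: "0 < c2" "\<And>r. continuous_map unit_interval unit_interval r \<Longrightarrow> (\<And>s. 0 \<le> s \<Longrightarrow> s \<le> 1 \<Longrightarrow> \<bar>r s - s\<bar> \<le> c2) \<Longrightarrow>
     small_homotopic (bicube m n) Y \<epsilon> f2 (\<lambda>p. f2 (fst p, cubemap n r (snd p)))"
      by (rule small_homotopic_cubemap[OF f2 \<epsilon>], rule that) blast+
    obtain c3 where c3: "0 < c3" "\<And>r. continuous_map unit_interval unit_interval r \<Longrightarrow> (\<And>s. 0 \<le> s \<Longrightarrow> s \<le> 1 \<Longrightarrow> \<bar>r s - s\<bar> \<le> c3) \<Longrightarrow>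
     small_homotopic (bicube m k) X \<epsilon> g1 (\<lambda>p. g1 (fst p, cubemap k r (snd p)))"
      by (rule small_homotopic_cubemap[OF g1 \<epsilon>], rule that) blast+
    obtain c4 where c4: "0 < c4" "\<And>r. continuous_map unit_interval unit_interval r \<Longrightarrow> (\<And>s. 0 \<le> s \<Longrightarrow> s \<le> 1 \<Longrightarrow> \<bar>r s - s\<bar> \<le> c4) \<Longrightarrow>
     small_homotopic (bicube m k) Y \<epsilon> g2 (\<lambda>p. g2 (fst p, cubemap k r (snd p)))"
      by (rule small_homotopic_cubemap[OF g2 \<epsilon>], rule that) blast+
    \<comment> \<open>One pair of grid maps has to be close enough to the identity for all four
      components.\<close>
    have "0 < min (min c1 c2) (min c3 c4)" using c1 c2 c3 c4 by simp
    then obtain r1 r2 and G :: "real set" where G: "finite G" "G \<subseteq> {0..1}"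
      and r: "continuous_map unit_interval unit_interval r1" "continuous_map unit_interval unit_interval r2"
      and rc: "\<And>s. 0 \<le> s \<Longrightarrow> s \<le> 1 \<Longrightarrow> \<bar>r1 s - s\<bar> \<le> min (min c1 c2) (min c3 c4)"
         "\<And>s. 0 \<le> s \<Longrightarrow> s \<le> 1 \<Longrightarrow> \<bar>r2 s - s\<bar> \<le> min (min c1 c2) (min c3 c4)"
      and rG: "\<And>s. 0 \<le> s \<Longrightarrow> s \<le> 1 \<Longrightarrow> r1 s \<in> G \<or> r2 s \<in> G"
      by (rule grid_maps) blast
    have cm: "continuous_map (bicube m k) (bicube m k) (\<lambda>p. (fst p, cubemap k r (snd p)))"
      if "continuous_map unit_interval unit_interval r" for r k
      unfolding continuous_map_paired
      using continuous_map_compose2[OF continuous_map_cubemap[OF that] continuous_map_snd] continuous_map_fst by blast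
    have h: "small_homotopic (bicube m n) X \<epsilon> f1 (\<lambda>p. f1 (fst p, cubemap n r1 (snd p)))"
      "small_homotopic (bicube m n) Y \<epsilon> f2 (\<lambda>p. f2 (fst p, cubemap n r2 (snd p)))"
      "small_homotopic (bicube m k) X \<epsilon> g1 (\<lambda>p. g1 (fst p, cubemap k r1 (snd p)))"
      "small_homotopic (bicube m k) Y \<epsilon> g2 (\<lambda>p. g2 (fst p, cubemap k r2 (snd p)))"
      using rc by (intro c1 c2 c3 c4 r; simp)+
    have fin: "(fst (fst p, cubemap n r1 (snd p)) = fst (fst q, cubemap k r1 (snd q)) \<and>
            A1 G (snd (fst p, cubemap n r1 (snd p))) (snd (fst q, cubemap k r1 (snd q)))) \<or>
          (fst (fst p, cubemap n r2 (snd p)) = fst (fst q, cubemap k r2 (snd q)) \<and>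
            A2 G (snd (fst p, cubemap n r2 (snd p))) (snd (fst q, cubemap k r2 (snd q))))"
      if "p \<in> topspace (bicube m n)" "q \<in> topspace (bicube m k)" "fst p = fst q" for p q
      using A[of r1 G r2 "snd p" "snd q"] rG that by (auto simp: mem_Times_iff)
    show "\<exists>\<phi>1 \<phi>2 \<psi>1 \<psi>2 R1 R2. continuous_map (bicube m n) (bicube m n) \<phi>1 \<and> continuous_map (bicube m n) (bicube m n) \<phi>2 \<and>
        continuous_map (bicube m k) (bicube m k) \<psi>1 \<and> continuous_map (bicube m k) (bicube m k) \<psi>2 \<and>
        small_homotopic (bicube m n) X \<epsilon> f1 (\<lambda>x. f1 (\<phi>1 x)) \<and> small_homotopic (bicube m n) Y \<epsilon> f2 (\<lambda>x. f2 (\<phi>2 x)) \<and>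
        small_homotopic (bicube m k) X \<epsilon> g1 (\<lambda>x. g1 (\<psi>1 x)) \<and> small_homotopic (bicube m k) Y \<epsilon> g2 (\<lambda>x. g2 (\<psi>2 x)) \<and>
        avoidable (bicube m n) (bicube m k) X R1 \<and> avoidable (bicube m n) (bicube m k) Y R2 \<and>
        (\<forall>x\<in>topspace (bicube m n). \<forall>y\<in>topspace (bicube m k). fst x = fst y \<longrightarrow> R1 (\<phi>1 x) (\<psi>1 y) \<or> R2 (\<phi>2 x) (\<psi>2 y))"
      apply (rule exI[of _ "\<lambda>p. (fst p, cubemap n r1 (snd p))"])
      apply (rule exI[of _ "\<lambda>p. (fst p, cubemap n r2 (snd p))"])
      apply (rule exI[of _ "\<lambda>p. (fst p, cubemap k r1 (snd p))"])
      apply (rule exI[of _ "\<lambda>p. (fst p, cubemap k r2 (snd p))"])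
      apply (rule exI[of _ "\<lambda>p q. fst p = fst q \<and> A1 G (snd p) (snd q)"])
      apply (rule exI[of _ "\<lambda>p q. fst p = fst q \<and> A2 G (snd p) (snd q)"])
      by (intro conjI cm r h X Y G ballI impI fin)
  qed
  then show ?thesis
    by (simp add: fiberwise_DD_iff_avoidable flip: mtopology_of_prod_metric)
qed

text \<open>Only the second cube is cut up: with b + 1 coordinates pinned it has dimension
  \<open>a\<close> and \<open>X\<close> separates; with a + 1 pinned it has dimension
  \<open>b\<close> and \<open>Y\<close> separates.\<close>

lemma first_multiplication_formula_finite:
  assumes X: "fiberwise_DD m n (enat a) (mtopology_of X)" and Y: "fiberwise_DD m n (enat b) (mtopology_of Y)"
    and k: "k = enat (a + b + 1)"
  shows "fiberwise_DD m n k (prod_topology (mtopology_of X) (mtopology_of Y))"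
proof (rule product_by_grids)
  fix G :: "real set" assume G: "finite G" "G \<subseteq> {0..1}"
  show "avoidable (bicube m n) (bicube m k) X (\<lambda>p q. fst p = fst q \<and> thick k (b + 1) G (snd q))"
    using avoidable_thick[OF X G, of n 0 k "b + 1"] k
    by (auto simp: zero_enat_def[symmetric] intro: avoidable_mono)
  show "avoidable (bicube m n) (bicube m k) Y (\<lambda>p q. fst p = fst q \<and> thick k (a + 1) G (snd q))"
    using avoidable_thick[OF Y G, of n 0 k "a + 1"] k
    by (auto simp: zero_enat_def[symmetric] add_ac intro: avoidable_mono)
qed (rule thick_dichotomy[OF _ k]; blast)

lemma first_multiplication_formula:
  assumes XY: "metrizable_space X" "metrizable_space Y"
    and X: "fiberwise_DD m n k1 X" and Y: "fiberwise_DD m n k2 Y"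
  shows "fiberwise_DD m n (k1 + k2 + 1) (prod_topology X Y)"
proof (cases "k1 = \<infinity> \<or> k2 = \<infinity>")
  \<comment> \<open>k1 + k2 + 1 is then \<infinity> and equals whichever of \<open>k1\<close> and
    \<open>k2\<close> is infinite, so that factor alone suffices.\<close>
  case True
  then show ?thesis
    using fiberwise_DD_prod_left[OF XY, of m n k1] X
      fiberwise_DD_prod_commute[OF fiberwise_DD_prod_left[OF XY(2,1), of m n k2]] Y by auto
next
  case False
  then obtain a b where ab: "k1 = enat a" "k2 = enat b" by auto
  obtain mX where mX: "X = mtopology_of mX" using XY(1) by (rule metrizable_obtain_metric)
  obtain mY where mY: "Y = mtopology_of mY" using XY(2) by (rule metrizable_obtain_metric)
  show ?thesis
    unfolding mX mY
    by (rule first_multiplication_formula_finite[OF X[unfolded mX ab] Y[unfolded mY ab]]) (simp add: ab one_enat_def)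
qed

text \<open>\<open>X\<close> separates the points if both are thick under \<open>r1\<close>. If one
  of them is not, it is thick under \<open>r2\<close>, and the two hypotheses on \<open>Y\<close>
  handle the two possibilities, each leaving the other cube whole.\<close>

lemma second_multiplication_formula_finite:
  assumes X: "fiberwise_DD m (enat a1) (enat b1) (mtopology_of X)"
    and Y: "fiberwise_DD m n (enat b2) (mtopology_of Y)" "fiberwise_DD m (enat a2) k (mtopology_of Y)"
    and n: "n = enat (a1 + a2 + 1)" and k: "k = enat (b1 + b2 + 1)"
  shows "fiberwise_DD m n k (prod_topology (mtopology_of X) (mtopology_of Y))"
proof (rule product_by_grids)
  fix G :: "real set" assume G: "finite G" "G \<subseteq> {0..1}"
  show "avoidable (bicube m n) (bicube m k) X (\<lambda>p q. fst p = fst q \<and> thick n (a2 + 1) G (snd p) \<and> thick k (b2 + 1) G (snd q))"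
    using avoidable_thick[OF X G, of n "a2 + 1" k "b2 + 1"] n k by (auto intro: avoidable_mono)
  obtain R1 where R1: "avoidable (bicube m n) (bicube m k) Y R1" "closed_rel (bicube m n) (bicube m k) R1"
    "\<And>p q. fst p = fst q \<Longrightarrow> thick k (b1 + 1) G (snd q) \<Longrightarrow> R1 p q"
    using avoidable_thick[OF Y(1) G, of n 0 k "b1 + 1"] k by (auto simp: zero_enat_def[symmetric] add_ac)
  obtain R2 where R2: "avoidable (bicube m n) (bicube m k) Y R2" 
    "\<And>p q. fst p = fst q \<Longrightarrow> thick n (a1 + 1) G (snd p) \<Longrightarrow> R2 p q"
    using avoidable_thick[OF Y(2) G, of n "a1 + 1" k 0] n by (auto simp: zero_enat_def[symmetric] add_ac)
  show "avoidable (bicube m n) (bicube m k) Y (\<lambda>p q. fst p = fst q \<and> (thick k (b1 + 1) G (snd q) \<or> thick n (a1 + 1) G (snd p)))"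
    by (rule avoidable_mono[OF avoidable_Un[OF compact_bicube compact_bicube R1(1) R2(1) R1(2)]]) (use R1(3) R2(2) in blast)
next
  fix G :: "real set" and r1 r2 :: "real \<Rightarrow> real" and x y
  assume r: "\<And>s. 0 \<le> s \<Longrightarrow> s \<le> 1 \<Longrightarrow> r1 s \<in> G \<or> r2 s \<in> G" and x: "x \<in> topspace (cube n)" and y: "y \<in> topspace (cube k)"
  show "(thick n (a2 + 1) G (cubemap n r1 x) \<and> thick k (b2 + 1) G (cubemap k r1 y)) \<or>
        (thick k (b1 + 1) G (cubemap k r2 y) \<or> thick n (a1 + 1) G (cubemap n r2 x))"
    using thick_dichotomy[OF x n, of r1 G r2] thick_dichotomy[OF y k, of r1 G r2] r by blast
qed

lemma second_multiplication_formula: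
  assumes XY: "metrizable_space X" "metrizable_space Y"
    and n: "n = n1 + n2 + 1" and k: "k = k1 + k2 + 1"
    and X: "fiberwise_DD m n1 k1 X" and Y: "fiberwise_DD m n k2 Y" "fiberwise_DD m n2 k Y"
  shows "fiberwise_DD m n k (prod_topology X Y)"
proof -
  \<comment> \<open>If \<open>k2\<close> or \<open>n2\<close> is infinite, then k = k2 or n = n2,
    and a hypothesis on \<open>Y\<close> is already the claim for \<open>Y\<close>. If
    \<open>k1\<close> or \<open>n1\<close> is infinite, then k = k1 or n = n1, and the first formula
    applies to the other dimension.\<close>
  consider "k2 = \<infinity> \<or> n2 = \<infinity>" | "k1 = \<infinity>" | "n1 = \<infinity>" | a1 a2 b1 b2 where "n1 = enat a1" "n2 = enat a2" "k1 = enat b1" "k2 = enat b2"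
    by (cases n1; cases n2; cases k1; cases k2) auto
  then show ?thesis
  proof cases
    case 1
    then have "fiberwise_DD m n k Y" using Y n k by auto
    then show ?thesis by (rule fiberwise_DD_prod_commute[OF fiberwise_DD_prod_left[OF XY(2,1)]])
  next
    case 2
    then have "k = k1" using k by simp
    then show ?thesis
      using first_multiplication_formula[OF XY fiberwise_DD_sym[OF X] fiberwise_DD_sym[OF Y(2)[unfolded \<open>k = k1\<close>]]] n
      by (auto intro: fiberwise_DD_sym)
  next
    case 3
    then have "n = n1" using n by simp
    then show ?thesis
      using first_multiplication_formula[OF XY X Y(1)[unfolded \<open>n = n1\<close>]] k by auto
  next
    case 4
    obtain mX where mX: "X = mtopology_of mX" using XY(1) by (rule metrizable_obtain_metric)
    obtain mY where mY: "Y = mtopology_of mY" using XY(2) by (rule metrizable_obtain_metric)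
    show ?thesis
      unfolding mX mY
      by (rule second_multiplication_formula_finite[OF X[unfolded mX 4] Y[unfolded mY 4]])
        (simp_all add: n k 4 one_enat_def)
  qed
qed

subsection \<open>Multiplication by a cell\<close>

lemma enat_Suc_less_eSuc [simp]: "enat (Suc i) < eSuc n \<longleftrightarrow> enat i < n"
  by (simp add: Suc_ile_eq)

lemma in_cube_iff:
  "x \<in> topspace (cube n) \<longleftrightarrow> (\<forall>i. if enat i < n then 0 \<le> x i \<and> x i \<le> 1 else x i = undefined)"
  by (auto simp: topspace_cube PiE_iff extensional_def)

text \<open>Index 0 is separated from the successors. Since \<open>eSuc\<close> fixes \<infinity>,
  the same shift splits the Hilbert cube into an interval and a Hilbert cube.\<close>

lemma in_cube_eSuc_iff:
  "x \<in> topspace (cube (eSuc n)) \<longleftrightarrow> 0 \<le> x 0 \<and> x 0 \<le> 1 \<and> x \<circ> Suc \<in> topspace (cube n)"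
proof -
  have "(\<forall>i. P i) \<longleftrightarrow> P 0 \<and> (\<forall>i. P (Suc i))" for P :: "nat \<Rightarrow> bool"
    by (metis not0_implies_Suc)
  from this[of "\<lambda>i. if enat i < eSuc n then 0 \<le> x i \<and> x i \<le> 1 else x i = undefined"] show ?thesis
    unfolding in_cube_iff by (simp del: iless_Suc_eq add: zero_enat_def[symmetric])
qed

lemma case_nat_in_cube:
  "0 \<le> t \<Longrightarrow> t \<le> 1 \<Longrightarrow> x \<in> topspace (cube n) \<Longrightarrow> case_nat t x \<in> topspace (cube (eSuc n))"
  by (simp add: in_cube_eSuc_iff o_def)

lemma tl_in_cube: "x \<in> topspace (cube (eSuc n)) \<Longrightarrow> x \<circ> Suc \<in> topspace (cube n)"
  by (simp add: in_cube_eSuc_iff)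

lemma hd_in_unit: "x \<in> topspace (cube (eSuc n)) \<Longrightarrow> 0 \<le> x 0 \<and> x 0 \<le> 1"
  by (rule in_cube_coord) (auto simp: zero_enat_def[symmetric])

lemma case_nat_hd_tl: "case_nat (x 0) (x \<circ> Suc) = x"
  by (auto simp: fun_eq_iff split: nat.split)

lemma case_nat_tl [simp]: "case_nat t x \<circ> Suc = x"
  by (auto simp: fun_eq_iff)

lemma continuous_map_case_nat:
  assumes "continuous_map K unit_interval t" "continuous_map K (cube n) x"
  shows "continuous_map K (cube (eSuc n)) (\<lambda>w. case_nat (t w) (x w))"
proof -
  have "continuous_map K euclideanreal (\<lambda>w. case_nat (t w) (x w) i)" if "enat i < eSuc n" for i
    using that assms by (cases i) (auto simp: continuous_map_unit_interval continuous_map_cube Suc_ile_eq)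
  then show ?thesis
    using assms by (auto simp: continuous_map_cube[of K "eSuc n"] intro!: case_nat_in_cube simp: continuous_map_unit_interval continuous_map_cube[of K n])
qed

lemma continuous_map_tl:
  assumes "continuous_map K (cube (eSuc n)) x"
  shows "continuous_map K (cube n) (\<lambda>w. x w \<circ> Suc)"
  using assms unfolding continuous_map_cube by (auto simp: tl_in_cube simp del: iless_Suc_eq)

lemma continuous_map_hd:
  assumes "continuous_map K (cube (eSuc n)) x"
  shows "continuous_map K unit_interval (\<lambda>w. x w 0)"
  using assms hd_in_unit by (auto simp: continuous_map_cube continuous_map_unit_interval zero_enat_def[symmetric])

text \<open>The tent function: its integer translates, weighted by prescribed node values, sum to
  the piecewise linear interpolant.\<close>

definition hat :: "real \<Rightarrow> real" where
  "hat u = max 0 (1 - \<bar>u\<bar>)"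

lemma hat_interpolation:
  assumes "i < N" "0 \<le> u" "u \<le> 1" "real N * s = real i + u"
  shows "(\<Sum>j\<le>N. b j * hat (real N * s - real j)) = (1 - u) * b i + u * b (Suc i)"
proof -
  have "(\<Sum>j\<le>N. b j * hat (real N * s - real j)) = (\<Sum>j\<in>{i, Suc i}. b j * hat (real N * s - real j))"
  proof (rule sum.mono_neutral_right)
    show "\<forall>j\<in>{..N} - {i, Suc i}. b j * hat (real N * s - real j) = 0"
    proof
      fix j assume "j \<in> {..N} - {i, Suc i}"
      then have "j + 1 \<le> i \<or> i + 2 \<le> j" by auto
      then have "real j + 1 \<le> real i \<or> real i + 2 \<le> real j" by linarith
      then have "1 \<le> \<bar>real N * s - real j\<bar>" using assms by linarith
      then show "b j * hat (real N * s - real j) = 0" by (simp add: hat_def)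
    qed
  qed (use assms in auto)
  also have "\<dots> = b i * hat u + b (Suc i) * hat (u - 1)"
    using assms by simp
  also have "\<dots> = (1 - u) * b i + u * b (Suc i)" using assms by (simp add: hat_def mult.commute)
  finally show ?thesis .
qed

text \<open>The second point s' is treated as the target of a motion starting at s, hence as part of
  a compact parameter space; after time \<open>c\<close> the motion has arrived at s'.\<close>

lemma uniformly_continuous_fibre:
  assumes W: "compact_space W" and f: "continuous_map (prod_topology W unit_interval) euclideanreal f" and e: "0 < e"
  obtains c where "0 < c" "\<And>w s s'. w \<in> topspace W \<Longrightarrow> s \<in> {0..1} \<Longrightarrow> s' \<in> {0..1} \<Longrightarrow> \<bar>s - s'\<bar> \<le> c \<Longrightarrow> \<bar>f (w, s) - f (w, s')\<bar> < e"
proof -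
  let ?K = "prod_topology (prod_topology W unit_interval) unit_interval"
  let ?P = "prod_topology ?K unit_interval"
  have id: "continuous_map ?P ?P (\<lambda>z. z)" by simp
  note c3 = continuous_map_fst2[OF id] note c2 = continuous_map_fst2[OF c3]
  obtain c where c: "0 < c" "c \<le> 1"
    and cs: "\<And>x t. x \<in> topspace ?K \<Longrightarrow> 0 \<le> t \<Longrightarrow> t \<le> c \<Longrightarrow>
      \<bar>f (fst x) - f (fst (fst x), move t (snd (fst x)) (snd x))\<bar> < e"
  proof (rule compact_uniformly_small)
    show "compact_space ?K" using W by (simp add: compact_space_prod_topology compact_space_subtopology)
    have "continuous_map ?P euclideanreal (\<lambda>z. move (snd z) (snd (fst (fst z))) (snd (fst z)))"
      by (intro continuous_map_move continuous_map_unit_real[OF continuous_map_snd2[OF id]]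
          continuous_map_unit_real[OF continuous_map_snd2[OF c2]] continuous_map_unit_real[OF continuous_map_snd2[OF c3]])
    then have "continuous_map ?P unit_interval (\<lambda>z. move (snd z) (snd (fst (fst z))) (snd (fst z)))"
      by (auto simp: continuous_map_unit_interval move_bounds)
    then have "continuous_map ?P (prod_topology W unit_interval) (\<lambda>z. (fst (fst (fst z)), move (snd z) (snd (fst (fst z))) (snd (fst z))))"
      using continuous_map_fst2[OF c2] by (simp only: continuous_map_paired)
    then have "continuous_map ?P euclideanreal (\<lambda>z. f (fst (fst (fst z)), move (snd z) (snd (fst (fst z))) (snd (fst z))))"
      by (rule continuous_map_compose2[OF f])
    then show "continuous_map ?P euclideanreal
        (\<lambda>z. \<bar>f (fst (fst z)) - f (fst (fst (fst z)), move (snd z) (snd (fst (fst z))) (snd (fst z)))\<bar>)"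
      by (intro continuous_intros continuous_map_compose2[OF f c2])
  qed (use e in auto)
  show ?thesis
  proof (rule that[OF c(1)])
    fix w s s' assume "w \<in> topspace W" "s \<in> {0..1}" "s' \<in> {0..1}" "\<bar>s - s'\<bar> \<le> c"
    then show "\<bar>f (w, s) - f (w, s')\<bar> < e"
      using cs[of "((w, s), s')" c] c by (simp add: move_reached)
  qed
qed

text \<open>\<open>F\<close> interpolates a copy of \<open>f\<close> shifted alternately up and down at the nodes of a fine
  grid; this makes every \<open>F (w, -)\<close> strictly monotone on each cell, with inverse \<open>\<sigma> i (w, -)\<close>.\<close>

lemma zigzag:
  assumes W: "compact_space W" and f: "continuous_map (prod_topology W unit_interval) unit_interval f" and \<epsilon>: "0 < \<epsilon>"
  obtains N :: nat and F \<sigma> where "0 < N" "continuous_map (prod_topology W unit_interval) unit_interval F"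
    "\<And>w s. w \<in> topspace W \<Longrightarrow> s \<in> {0..1} \<Longrightarrow> \<bar>f (w, s) - F (w, s)\<bar> < \<epsilon>"
    "\<And>i. i < N \<Longrightarrow> continuous_map (prod_topology W unit_interval) unit_interval (\<sigma> i)"
    "\<forall>i w s. i < N \<longrightarrow> w \<in> topspace W \<longrightarrow> s \<in> {0..1} \<longrightarrow> real i \<le> real N * s \<longrightarrow> real N * s \<le> real i + 1 \<longrightarrow> \<sigma> i (w, F (w, s)) = s"
proof -
  let ?P = "prod_topology W unit_interval"
  \<comment> \<open>The bound 1/4 keeps the factor 1 - 2e of the squeeze below positive;
    \<epsilon>/4 suffices because the total error is at most 3e.\<close>
  define e where "e = min (1/4) (\<epsilon>/4)"
  have e: "0 < e" "e \<le> 1/4" "e \<le> \<epsilon>/4" using \<epsilon> by (auto simp: e_def)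
  have fr: "continuous_map ?P euclideanreal f" using continuous_map_unit_real[OF f] .
  have f01: "0 \<le> f (w, s) \<and> f (w, s) \<le> 1" if "w \<in> topspace W" "s \<in> {0..1}" for w s
    using continuous_map_in_topspace[OF f, of "(w, s)"] that by auto
  obtain c where c: "0 < c" "\<And>w s s'. w \<in> topspace W \<Longrightarrow> s \<in> {0..1} \<Longrightarrow> s' \<in> {0..1} \<Longrightarrow> \<bar>s - s'\<bar> \<le> c \<Longrightarrow> \<bar>f (w, s) - f (w, s')\<bar> < e"
    using uniformly_continuous_fibre[OF W fr e(1)] by metis
  obtain N where N: "0 < N" "inverse (real N) < c"
    using reals_Archimedean[OF c(1)] by blast
  define nd where "nd = (\<lambda>i::nat. real i / real N)"
  have nd: "nd i \<in> {0..1}" if "i \<le> N" for i using that N by (auto simp: nd_def)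
  \<comment> \<open>Squeezing \<open>f\<close> into the interval from e to 1 - e makes room for
    shifts by e up or down.\<close>
  define a where "a = (\<lambda>i w. (1 - 2 * e) * f (w, nd i) + e + (- 1) ^ i * e)"
  have pm: "(- 1 :: real) ^ i = 1 \<or> (- 1 :: real) ^ i = - 1" for i by (cases "even i") auto
  have a01: "0 \<le> a i w \<and> a i w \<le> 1" and af: "\<bar>a i w - f (w, nd i)\<bar> \<le> 2 * e" if "i \<le> N" "w \<in> topspace W" for i w
  proof -
    have f': "0 \<le> f (w, nd i)" "f (w, nd i) \<le> 1" using f01[OF that(2) nd[OF that(1)]] by auto
    have 1: "0 \<le> (1 - 2 * e) * f (w, nd i)" "(1 - 2 * e) * f (w, nd i) \<le> 1 - 2 * e"
      using f' e by (auto intro: mult_left_le)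
    have 2: "0 \<le> e * f (w, nd i)" "e * f (w, nd i) \<le> e" using f' e by (auto intro: mult_left_le)
    have "a i w = (1 - 2 * e) * f (w, nd i) + e + e \<or> a i w = (1 - 2 * e) * f (w, nd i) + e - e"
      using pm[of i] by (auto simp: a_def)
    then show "0 \<le> a i w \<and> a i w \<le> 1" using 1 e by linarith
    have "a i w - f (w, nd i) = - 2 * (e * f (w, nd i)) + e + (- 1) ^ i * e"
      by (simp add: a_def algebra_simps)
    then show "\<bar>a i w - f (w, nd i)\<bar> \<le> 2 * e" using pm[of i] 2 by auto
  qed
  \<comment> \<open>Between neighbouring nodes \<open>f\<close> changes by less than e but the shift
    by 2e, so the shift decides the sign.\<close>
  have ne: "a (Suc i) w - a i w \<noteq> 0" if "i < N" "w \<in> topspace W" for i w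
  proof -
    have "\<bar>f (w, nd (Suc i)) - f (w, nd i)\<bar> < e"
      by (rule c(2)) (use that nd[of i] nd[of "Suc i"] N in \<open>auto simp: nd_def diff_divide_distrib[symmetric] inverse_eq_divide\<close>)
    moreover have "\<bar>(1 - 2 * e) * (f (w, nd (Suc i)) - f (w, nd i))\<bar> \<le> \<bar>f (w, nd (Suc i)) - f (w, nd i)\<bar>"
      unfolding abs_mult using e by (intro mult_left_le_one_le) auto
    moreover have "a (Suc i) w - a i w = (1 - 2 * e) * (f (w, nd (Suc i)) - f (w, nd i)) - 2 * ((- 1) ^ i * e)"
      by (simp add: a_def algebra_simps)
    ultimately show ?thesis using pm[of i] e by auto
  qed
  have ac: "continuous_map ?P euclideanreal (\<lambda>z. a i (fst z))" if "i \<le> N" for i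
  proof -
    have "continuous_map ?P ?P (\<lambda>z. (fst z, nd i))"
      using nd[OF that] by (simp add: continuous_map_paired continuous_map_fst)
    then have "continuous_map ?P euclideanreal (\<lambda>z. f (fst z, nd i))" by (rule continuous_map_compose2[OF fr])
    then show ?thesis unfolding a_def by (intro continuous_map_add continuous_map_real_mult continuous_map_canonical_const)
  qed
  define F where "F = (\<lambda>z. \<Sum>j\<le>N. a j (fst z) * hat (real N * snd z - real j))"
  \<comment> \<open>This solves the affine equation for the variable on cell \<open>i\<close>. The
    clamp gives a map into the interval also at values that \<open>F\<close> does not attain on that
    cell.\<close>
  define \<sigma> where "\<sigma> = (\<lambda>i z. max 0 (min 1 ((real i + (snd z - a i (fst z)) / (a (Suc i) (fst z) - a i (fst z))) / real N)))"
  have snd: "continuous_map ?P euclideanreal snd"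
    using continuous_map_unit_real[OF continuous_map_snd] .
  have Fcell: "F (w, s) = (1 - u) * a i w + u * a (Suc i) w"
    if "i < N" "0 \<le> u" "u \<le> 1" "real N * s = real i + u" for i u w s
    unfolding F_def using hat_interpolation[OF that, of "\<lambda>j. a j w"] by simp
  have Fclose: "0 \<le> F (w, s) \<and> F (w, s) \<le> 1 \<and> \<bar>f (w, s) - F (w, s)\<bar> < \<epsilon>" if w: "w \<in> topspace W" and s: "s \<in> {0..1}" for w s
  proof -
    obtain i u where iu: "i < N" "0 \<le> u" "u \<le> 1" "real N * s = real i + u"
      using unit_interval_cell[of s N] s N by auto
    have s': "s = (real i + u) / real N" using iu N by (simp add: field_simps)
    \<comment> \<open>Squeeze and shift cost 2e at the node, and passing from the node to s costs
      another e.\<close>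
    have close: "\<bar>a j w - f (w, s)\<bar> \<le> 3 * e" if "j = i \<or> j = Suc i" for j
    proof -
      have j: "j \<le> N" using that iu by auto
      have "s - nd j = (real i + u - real j) / real N" unfolding s' nd_def by (simp add: diff_divide_distrib)
      also have "\<bar>\<dots>\<bar> \<le> inverse (real N)"
        using that iu N by (auto simp: inverse_eq_divide abs_if field_simps)
      finally have "\<bar>f (w, s) - f (w, nd j)\<bar> < e"
        using N by (intro c(2)[OF w s nd[OF j]]) auto
      then show ?thesis using af[OF j w] by linarith
    qed
    have "F (w, s) - f (w, s) = (1 - u) * (a i w - f (w, s)) + u * (a (Suc i) w - f (w, s))"
      unfolding Fcell[OF iu] by (simp add: algebra_simps)
    also have "\<bar>\<dots>\<bar> \<le> (1 - u) * (3 * e) + u * (3 * e)"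
      using close[of i] close[of "Suc i"] iu
      by (intro order_trans[OF abs_triangle_ineq] add_mono) (auto simp: abs_mult intro: mult_left_mono)
    also have "\<dots> = 3 * e" by (simp add: algebra_simps)
    finally have "\<bar>f (w, s) - F (w, s)\<bar> < \<epsilon>" using e by linarith
    moreover have "0 \<le> F (w, s)" unfolding Fcell[OF iu] using a01[OF _ w] iu by simp
    moreover have "F (w, s) \<le> (1 - u) * 1 + u * 1"
      unfolding Fcell[OF iu] using a01[OF _ w] iu by (intro add_mono mult_left_mono) auto
    ultimately show ?thesis by simp
  qed
  show ?thesis
  proof (rule that[OF N(1), of F \<sigma>])
    have "continuous_map ?P euclideanreal F"
      unfolding F_def hat_def by (intro continuous_intros ac snd) auto
    then show "continuous_map ?P unit_interval F"
      using Fclose by (auto simp: continuous_map_unit_interval)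
    show "\<bar>f (w, s) - F (w, s)\<bar> < \<epsilon>" if "w \<in> topspace W" "s \<in> {0..1}" for w s using Fclose[OF that] by simp
    show "continuous_map ?P unit_interval (\<sigma> i)" if i: "i < N" for i
    proof -
      have "continuous_map ?P euclideanreal (\<sigma> i)"
        unfolding \<sigma>_def using i N ne[OF i] by (intro continuous_intros ac snd) auto
      then show ?thesis by (simp add: continuous_map_unit_interval \<sigma>_def)
    qed
    have "\<sigma> i (w, F (w, s)) = s" if i: "i < N" and w: "w \<in> topspace W" and s: "s \<in> {0..1}"
        and cell: "real i \<le> real N * s" "real N * s \<le> real i + 1" for i w s
    proof -
      define u where "u = real N * s - real i"
      have u: "0 \<le> u" "u \<le> 1" "real N * s = real i + u" using cell by (auto simp: u_def)
      have "F (w, s) - a i w = u * (a (Suc i) w - a i w)"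
        unfolding Fcell[OF i u] by (simp add: algebra_simps)
      then have "(F (w, s) - a i w) / (a (Suc i) w - a i w) = u" using ne[OF i w] by simp
      moreover have "(real i + u) / real N = s" using u N by (simp add: field_simps)
      ultimately show ?thesis using s by (simp add: \<sigma>_def)
    qed
    then show "\<forall>i w s. i < N \<longrightarrow> w \<in> topspace W \<longrightarrow> s \<in> {0..1} \<longrightarrow> real i \<le> real N * s \<longrightarrow> real N * s \<le> real i + 1 \<longrightarrow> \<sigma> i (w, F (w, s)) = s"
      by blast
  qed
qed

section \<open>Trading a variable for a parameter\<close>

definition unit_metric :: "real metric" where
  "unit_metric = submetric euclidean_metric {0..1}"

lemma mtopology_of_unit_metric: "mtopology_of unit_metric = unit_interval"
  by (simp add: unit_metric_def mtopology_of_submetric)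

lemma small_homotopic_unit:
  assumes f: "continuous_map K unit_interval f" and g: "continuous_map K unit_interval g"
    and close: "\<And>x. x \<in> topspace K \<Longrightarrow> \<bar>f x - g x\<bar> < \<epsilon>"
  shows "small_homotopic K unit_metric \<epsilon> f g"
proof -
  let ?P = "prod_topology K unit_interval"
  define h where "h = (\<lambda>z. f (fst z) + snd z * (g (fst z) - f (fst z)))"
  have "continuous_map ?P euclideanreal h"
    unfolding h_def
    by (intro continuous_intros continuous_map_unit_real[OF continuous_map_snd]
        continuous_map_compose2[OF continuous_map_unit_real[OF f]] continuous_map_compose2[OF continuous_map_unit_real[OF g]] continuous_map_fst)
  moreover have "0 \<le> h (x, t) \<and> h (x, t) \<le> 1" if "x \<in> topspace K" "0 \<le> t" "t \<le> 1" for x t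
  proof -
    have fg: "0 \<le> f x" "f x \<le> 1" "0 \<le> g x" "g x \<le> 1"
      using f g that by (auto simp: continuous_map_unit_interval)
    have "h (x, t) = (1 - t) * f x + t * g x" by (simp add: h_def algebra_simps)
    moreover have "(1 - t) * f x + t * g x \<le> (1 - t) * 1 + t * 1"
      using fg that by (intro add_mono mult_left_mono) auto
    ultimately show ?thesis using fg that by simp
  qed
  ultimately have "continuous_map ?P unit_interval h"
    by (auto simp: continuous_map_unit_interval)
  moreover have "dist (f x) (h (x, t)) < \<epsilon>" if "x \<in> topspace K" "0 \<le> t" "t \<le> 1" for x t
  proof -
    have "dist (f x) (h (x, t)) = \<bar>t\<bar> * \<bar>f x - g x\<bar>"
      by (simp add: h_def dist_real_def abs_mult abs_minus_commute)
    also have "\<dots> \<le> \<bar>f x - g x\<bar>" using that by (intro mult_left_le_one_le) auto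
    finally show ?thesis using close[OF that(1)] by simp
  qed
  ultimately show ?thesis
    unfolding small_homotopic_def mtopology_of_unit_metric
    by (intro exI[of _ h]) (auto simp: h_def unit_metric_def)
qed

text \<open>The value of \<open>F\<close> is prepended to the parameters and the distinguished
  variable is dropped; on the slab nothing is lost, because \<sigma> recovers the variable. Clamping
  to the range from \<open>a\<close> to \<open>b\<close> retracts onto the slab, and \<delta> is the
  distance from it.\<close>

lemma pinching_slab:
  fixes F \<sigma> :: "((nat \<Rightarrow> real) \<times> (nat \<Rightarrow> real)) \<times> real \<Rightarrow> real"
  assumes F: "continuous_map (prod_topology (bicube m n) unit_interval) unit_interval F"
    and \<sigma>: "continuous_map (prod_topology (bicube m n) unit_interval) unit_interval \<sigma>"
    and inv: "\<And>w s. w \<in> topspace (bicube m n) \<Longrightarrow> a \<le> s \<Longrightarrow> s \<le> b \<Longrightarrow> \<sigma> (w, F (w, s)) = s"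
    and ab: "0 \<le> a" "a \<le> b" "b \<le> 1"
  shows "pinching (bicube m (eSuc n)) (bicube (eSuc m) n)
    (\<lambda>p. (case_nat (F ((fst p, snd p \<circ> Suc), max a (min b (snd p 0)))) (fst p), snd p \<circ> Suc))
    (\<lambda>p. \<bar>snd p 0 - max a (min b (snd p 0))\<bar>)"
proof -
  let ?K = "bicube m (eSuc n)" and ?K' = "bicube (eSuc m) n"
  let ?P = "prod_topology ?K unit_interval"
  let ?cl = "\<lambda>s. max a (min b s)"
  let ?e = "\<lambda>p. (case_nat (F ((fst p, snd p \<circ> Suc), ?cl (snd p 0))) (fst p), snd p \<circ> Suc)"
  \<comment> \<open>\<open>r\<close> undoes \<open>e\<close> on the slab; at all other parameter
    values only continuity of \<sigma> is asked.\<close>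
  define r :: "(nat \<Rightarrow> real) \<times> (nat \<Rightarrow> real) \<Rightarrow> (nat \<Rightarrow> real) \<times> (nat \<Rightarrow> real)"
    where "r = (\<lambda>p. (fst p \<circ> Suc, case_nat (\<sigma> ((fst p \<circ> Suc, snd p), fst p 0)) (snd p)))"
  define q :: "((nat \<Rightarrow> real) \<times> (nat \<Rightarrow> real)) \<times> real \<Rightarrow> (nat \<Rightarrow> real) \<times> (nat \<Rightarrow> real)"
    where "q = (\<lambda>w. (fst (fst w), case_nat (move (snd w) (snd (fst w) 0) (?cl (snd (fst w) 0))) (snd (fst w) \<circ> Suc)))"
  have cl: "continuous_map K unit_interval (\<lambda>x. ?cl (g x))" if "continuous_map K unit_interval g" for g and K :: "'k topology"
    using that ab by (auto simp: continuous_map_unit_interval intro!: continuous_intros)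
  have hd: "continuous_map ?K unit_interval (\<lambda>p. snd p 0)" by (rule continuous_map_hd[OF continuous_map_snd])
  have tl: "continuous_map ?K (cube n) (\<lambda>p. snd p \<circ> Suc)" by (rule continuous_map_tl[OF continuous_map_snd])
  have clK: "continuous_map ?K unit_interval (\<lambda>p. ?cl (snd p 0))" 
    using hd ab by (auto simp: continuous_map_unit_interval intro!: continuous_intros)
  have "continuous_map ?K (prod_topology (bicube m n) unit_interval) (\<lambda>p. ((fst p, snd p \<circ> Suc), ?cl (snd p 0)))"
    by (simp only: continuous_map_paired continuous_map_fst tl clK simp_thms)
  then have e: "continuous_map ?K ?K' ?e"
    by (simp only: continuous_map_paired tl simp_thms continuous_map_case_nat[OF continuous_map_compose2[OF F] continuous_map_fst])
  have hd': "continuous_map ?K' unit_interval (\<lambda>p. fst p 0)" by (rule continuous_map_hd[OF continuous_map_fst])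
  have tl': "continuous_map ?K' (cube m) (\<lambda>p. fst p \<circ> Suc)" by (rule continuous_map_tl[OF continuous_map_fst])
  have "continuous_map ?K' (prod_topology (bicube m n) unit_interval) (\<lambda>p. ((fst p \<circ> Suc, snd p), fst p 0))"
    by (simp only: continuous_map_paired continuous_map_snd tl' hd' simp_thms)
  then have r: "continuous_map ?K' ?K r"
    unfolding r_def
    by (simp only: continuous_map_paired tl' simp_thms continuous_map_case_nat[OF continuous_map_compose2[OF \<sigma>] continuous_map_snd])
  have mv: "continuous_map ?P euclideanreal (\<lambda>w. move (snd w) (snd (fst w) 0) (?cl (snd (fst w) 0)))"
    by (intro continuous_map_move continuous_map_unit_real[OF continuous_map_snd]
         continuous_map_compose2[OF continuous_map_unit_real[OF hd] continuous_map_fst]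
         continuous_map_compose2[OF continuous_map_unit_real[OF clK] continuous_map_fst])
  have "0 \<le> move (snd w) (snd (fst w) 0) (?cl (snd (fst w) 0)) \<and> move (snd w) (snd (fst w) 0) (?cl (snd (fst w) 0)) \<le> 1"
    if "w \<in> topspace ?P" for w
    using that hd_in_unit[of "snd (fst w)" n] ab by (intro move_bounds) auto
  then have mv': "continuous_map ?P unit_interval (\<lambda>w. move (snd w) (snd (fst w) 0) (?cl (snd (fst w) 0)))"
    using mv by (simp only: continuous_map_unit_interval) blast
  have q: "continuous_map ?P ?K q"
    unfolding q_def
    by (simp only: continuous_map_paired simp_thms continuous_map_compose2[OF continuous_map_fst continuous_map_fst]
       continuous_map_case_nat[OF mv' continuous_map_compose2[OF tl continuous_map_fst]])
  have \<delta>: "continuous_map ?K euclideanreal (\<lambda>p. \<bar>snd p 0 - ?cl (snd p 0)\<bar>)"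
    by (intro continuous_intros continuous_map_unit_real[OF hd])
  have q0: "q (p, 0) = p" for p
    by (simp add: q_def case_nat_hd_tl)
  have q1: "q (p, s) = r (?e p)" if p: "p \<in> topspace ?K" and s: "\<bar>snd p 0 - ?cl (snd p 0)\<bar> \<le> s" for p s
  proof -
    have "(fst p, snd p \<circ> Suc) \<in> topspace (bicube m n)" using p tl_in_cube by (auto simp: mem_Times_iff)
    then have "\<sigma> ((fst p, snd p \<circ> Suc), F ((fst p, snd p \<circ> Suc), ?cl (snd p 0))) = ?cl (snd p 0)"
      using ab by (intro inv) auto
    then show ?thesis using move_reached[OF s] by (simp add: q_def r_def)
  qed
  show ?thesis
    unfolding pinching_def
    by (intro conjI e \<delta> exI[of _ r] exI[of _ q] r q) (auto simp: q0 q1)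
qed

text \<open>Every point lies in some slab, and there the new parameter is the value of
  \<open>f'\<close> itself. This link turns equal interval components into equal enlarged
  parameters.\<close>

lemma zigzag_cube:
  assumes f: "continuous_map (bicube m (eSuc n)) unit_interval f" and \<epsilon>: "0 < \<epsilon>"
  obtains N :: nat and f' e \<delta> where
    "continuous_map (bicube m (eSuc n)) unit_interval f'"
    "\<And>p. p \<in> topspace (bicube m (eSuc n)) \<Longrightarrow> \<bar>f p - f' p\<bar> < \<epsilon>"
    "\<And>i. i < N \<Longrightarrow> pinching (bicube m (eSuc n)) (bicube (eSuc m) n) (e i) (\<delta> i)"
    "\<And>p. p \<in> topspace (bicube m (eSuc n)) \<Longrightarrow> \<exists>i<N. \<delta> i p = 0 \<and> fst (e i p) = case_nat (f' p) (fst p)"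
proof -
  let ?K = "bicube m (eSuc n)" and ?W = "bicube m n"
  \<comment> \<open>The distinguished variable is coordinate 0 of the second cube; the remaining
    variables form the compact space over which the zigzag is built.\<close>
  define fW where "fW = (\<lambda>z. f (fst (fst z), case_nat (snd z) (snd (fst z))))"
  have id: "continuous_map (prod_topology ?W unit_interval) (prod_topology ?W unit_interval) (\<lambda>z. z)" by simp
  have "continuous_map (prod_topology ?W unit_interval) ?K (\<lambda>z. (fst (fst z), case_nat (snd z) (snd (fst z))))"
    unfolding continuous_map_paired
    by (intro conjI continuous_map_case_nat continuous_map_snd continuous_map_fst2[OF continuous_map_fst2[OF id]]
          continuous_map_snd2[OF continuous_map_fst2[OF id]])
  then have fW: "continuous_map (prod_topology ?W unit_interval) unit_interval fW"
    unfolding fW_def by (rule continuous_map_compose2[OF f])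
  obtain N F \<sigma> where N: "0 < N" and F: "continuous_map (prod_topology ?W unit_interval) unit_interval F"
    and close: "\<And>w s. w \<in> topspace ?W \<Longrightarrow> s \<in> {0..1} \<Longrightarrow> \<bar>fW (w, s) - F (w, s)\<bar> < \<epsilon>"
    and \<sigma>: "\<And>i. i < N \<Longrightarrow> continuous_map (prod_topology ?W unit_interval) unit_interval (\<sigma> i)"
    and inv: "\<forall>i w s. i < N \<longrightarrow> w \<in> topspace ?W \<longrightarrow> s \<in> {0..1} \<longrightarrow> real i \<le> real N * s \<longrightarrow> real N * s \<le> real i + 1 \<longrightarrow> \<sigma> i (w, F (w, s)) = s"
    by (rule zigzag[OF compact_bicube fW \<epsilon>], rule that; (assumption | simp))
  define f' where "f' = (\<lambda>p. F ((fst p, snd p \<circ> Suc), snd p 0))"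
  define lo where "lo = (\<lambda>i::nat. real i / real N)"
  define hi where "hi = (\<lambda>i::nat. (real i + 1) / real N)"
  define e where "e = (\<lambda>i p. (case_nat (F ((fst p, snd p \<circ> Suc), max (lo i) (min (hi i) (snd p 0)))) (fst p), snd p \<circ> Suc))"
  define \<delta> where "\<delta> = (\<lambda>i (p :: (nat \<Rightarrow> real) \<times> (nat \<Rightarrow> real)). \<bar>snd p 0 - max (lo i) (min (hi i) (snd p 0))\<bar>)"
  show ?thesis
  proof (rule that[of f' N e \<delta>])
    have "continuous_map ?K (prod_topology ?W unit_interval) (\<lambda>p. ((fst p, snd p \<circ> Suc), snd p 0))"
      unfolding continuous_map_paired
      by (intro conjI continuous_map_fst continuous_map_tl[OF continuous_map_snd] continuous_map_hd[OF continuous_map_snd])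
    then show "continuous_map ?K unit_interval f'"
      unfolding f'_def by (rule continuous_map_compose2[OF F])
    show "\<bar>f p - f' p\<bar> < \<epsilon>" if "p \<in> topspace ?K" for p
      using close[of "(fst p, snd p \<circ> Suc)" "snd p 0"] that tl_in_cube[of "snd p" n] hd_in_unit[of "snd p" n]
      by (simp add: f'_def fW_def mem_Times_iff case_nat_hd_tl)
    show "pinching ?K (bicube (eSuc m) n) (e i) (\<delta> i)" if i: "i < N" for i
      unfolding e_def \<delta>_def
    proof (rule pinching_slab[OF F \<sigma>[OF i]])
      have "real i + 1 \<le> real N" using i by simp
      then show lh: "0 \<le> lo i" "lo i \<le> hi i" "hi i \<le> 1" using N by (auto simp: lo_def hi_def divide_right_mono)
      fix w s assume w: "w \<in> topspace ?W" and s: "lo i \<le> s" "s \<le> hi i"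
      then have "s \<in> {0..1}" using lh by auto
      then show "\<sigma> i (w, F (w, s)) = s"
        using s N by (intro inv[rule_format] i w) (auto simp: lo_def hi_def field_simps)
    qed
    show "\<exists>i<N. \<delta> i p = 0 \<and> fst (e i p) = case_nat (f' p) (fst p)" if "p \<in> topspace ?K" for p
    proof -
      have "0 \<le> snd p 0" "snd p 0 \<le> 1" using hd_in_unit[of "snd p" n] that by (auto simp: mem_Times_iff)
      then obtain i u where iu: "i < N" "0 \<le> u" "u \<le> 1" "real N * snd p 0 = real i + u"
        using unit_interval_cell N by metis
      then have "lo i \<le> snd p 0" "snd p 0 \<le> hi i" using N by (auto simp: lo_def hi_def field_simps)
      then have "max (lo i) (min (hi i) (snd p 0)) = snd p 0" by simp
      then show ?thesis using iu by (intro exI[of _ i]) (simp add: \<delta>_def e_def f'_def)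
    qed
  qed
qed

text \<open>Colliding images over one parameter have equal interval components, hence equal
  parameters in the cube of dimension m + 1 on suitable slabs, where the \<open>X\<close>-components
  have been separated. The zigzags are chosen before the \<open>X\<close>-components move and stay
  unchanged, so the slabs remain valid.\<close>

lemma fiberwise_DD_unit_interval_prod:
  assumes X: "metrizable_space X" and DD: "fiberwise_DD (eSuc m) n k X"
  shows "fiberwise_DD m (eSuc n) (eSuc k) (prod_topology unit_interval X)"
proof -
  obtain mX where mX: "X = mtopology_of mX" using X by (rule metrizable_obtain_metric)
  let ?K = "bicube m (eSuc n)" and ?L = "bicube m (eSuc k)" and ?M = "prod_metric unit_metric mX"
  have "avoidable ?K ?L ?M (\<lambda>p q. fst p = fst q)"
    unfolding avoidable_def
  proof (intro allI impI)
    fix \<epsilon> :: real and f g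
    assume \<epsilon>: "0 < \<epsilon>" and fg: "continuous_map ?K (mtopology_of ?M) f \<and> continuous_map ?L (mtopology_of ?M) g"
    have e: "0 < \<epsilon>/2" using \<epsilon> by simp
    have "continuous_map ?K (prod_topology unit_interval (mtopology_of mX)) f"
      "continuous_map ?L (prod_topology unit_interval (mtopology_of mX)) g"
      using fg by (simp_all add: mtopology_of_unit_metric)
    note c = this[THEN continuous_map_fst2] this[THEN continuous_map_snd2]
    obtain N :: nat and f0 ef \<delta>f where f0: "continuous_map ?K unit_interval f0"
        "\<And>p. p \<in> topspace ?K \<Longrightarrow> \<bar>fst (f p) - f0 p\<bar> < \<epsilon>/2"
      and ef: "\<And>i. i < N \<Longrightarrow> pinching ?K (bicube (eSuc m) n) (ef i) (\<delta>f i)"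
      and cf: "\<And>p. p \<in> topspace ?K \<Longrightarrow> \<exists>i<N. \<delta>f i p = 0 \<and> fst (ef i p) = case_nat (f0 p) (fst p)"
      by (rule zigzag_cube[OF c(1) e]) blast
    obtain N' :: nat and g0 eg \<delta>g where g0: "continuous_map ?L unit_interval g0"
        "\<And>p. p \<in> topspace ?L \<Longrightarrow> \<bar>fst (g p) - g0 p\<bar> < \<epsilon>/2"
      and eg: "\<And>i. i < N' \<Longrightarrow> pinching ?L (bicube (eSuc m) k) (eg i) (\<delta>g i)"
      and cg: "\<And>p. p \<in> topspace ?L \<Longrightarrow> \<exists>i<N'. \<delta>g i p = 0 \<and> fst (eg i p) = case_nat (g0 p) (fst p)"
      by (rule zigzag_cube[OF c(2) e]) blast
    have "\<exists>R. avoidable ?K ?L mX R \<and> closed_rel ?K ?L R \<and> (\<forall>i\<in>{..<N}. \<forall>j\<in>{..<N'}. \<forall>x y.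
        \<delta>f i x = 0 \<longrightarrow> \<delta>g j y = 0 \<longrightarrow> fst (ef i x) = fst (eg j y) \<longrightarrow> R x y)"
      by (rule avoidable_pinching_UN[OF compact_bicube compact_bicube _ _ DD[unfolded mX]]) (simp_all add: ef eg)
    then obtain R where R: "avoidable ?K ?L mX R"
      and R': "\<forall>i\<in>{..<N}. \<forall>j\<in>{..<N'}. \<forall>x y. \<delta>f i x = 0 \<longrightarrow> \<delta>g j y = 0 \<longrightarrow> fst (ef i x) = fst (eg j y) \<longrightarrow> R x y"
      by (elim exE conjE)
    obtain f1 g1 where f1: "small_homotopic ?K mX (\<epsilon>/2) (\<lambda>p. snd (f p)) f1" and g1: "small_homotopic ?L mX (\<epsilon>/2) (\<lambda>p. snd (g p)) g1"
      and ne: "\<And>p q. p \<in> topspace ?K \<Longrightarrow> q \<in> topspace ?L \<Longrightarrow> R p q \<Longrightarrow> f1 p \<noteq> g1 q"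
      by (rule avoidableE[OF R e c(3,4)]) blast
    have "small_homotopic ?K ?M \<epsilon> f (\<lambda>p. (f0 p, f1 p))" "small_homotopic ?L ?M \<epsilon> g (\<lambda>p. (g0 p, g1 p))"
      using small_homotopic_pair[OF small_homotopic_unit[OF c(1) f0] f1] small_homotopic_pair[OF small_homotopic_unit[OF c(2) g0] g1]
      by simp_all
    moreover have "(f0 p, f1 p) \<noteq> (g0 q, g1 q)" if p: "p \<in> topspace ?K" and q: "q \<in> topspace ?L" and eq: "fst p = fst q" for p q
    proof
      assume "(f0 p, f1 p) = (g0 q, g1 q)"
      then have E: "f0 p = g0 q" "f1 p = g1 q" by auto
      obtain i where i: "i < N" "\<delta>f i p = 0" "fst (ef i p) = case_nat (f0 p) (fst p)" using cf[OF p] by blast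
      obtain j where j: "j < N'" "\<delta>g j q = 0" "fst (eg j q) = case_nat (g0 q) (fst q)" using cg[OF q] by blast
      have "R p q" by (rule R'[rule_format, of i j]) (use i j E eq in simp_all)
      then show False using ne[OF p q] E by simp
    qed
    ultimately show "\<exists>f' g'. small_homotopic ?K ?M \<epsilon> f f' \<and> small_homotopic ?L ?M \<epsilon> g g' \<and>
           (\<forall>x\<in>topspace ?K. \<forall>y\<in>topspace ?L. fst x = fst y \<longrightarrow> f' x \<noteq> g' y)"
      by (intro exI[of _ "\<lambda>p. (f0 p, f1 p)"] exI[of _ "\<lambda>p. (g0 p, g1 p)"]) simp
  qed
  then have "fiberwise_DD m (eSuc n) (eSuc k) (mtopology_of ?M)" by (simp only: fiberwise_DD_iff_avoidable)
  then show ?thesis by (simp add: mX mtopology_of_unit_metric)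
qed

lemma multiplication_by_cell:
  assumes X: "metrizable_space X" and DD: "fiberwise_DD m n k X"
  shows "enat d < m + 1 \<Longrightarrow> fiberwise_DD (m - enat d) (enat d + n) (enat d + k) (prod_topology (cube (enat d)) X)"
proof (induction d)
  case 0
  \<comment> \<open>The empty product is a single point, so in dimension 0 the product is a copy of
    \<open>X\<close>.\<close>
  have top0: "topspace (cube 0) = {\<lambda>_. undefined}"
    by (simp add: topspace_cube)
  have "homeomorphic_maps X (prod_topology (cube 0) X) (\<lambda>x. (\<lambda>_. undefined, x)) snd"
    unfolding homeomorphic_maps_def by (auto simp: continuous_map_paired continuous_map_snd top0)
  from fiberwise_DD_homeomorphic[OF DD this] show ?case
    by (simp add: zero_enat_def[symmetric])
next
  case (Suc d)
  let ?Z = "prod_topology (cube (enat d)) X"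
  \<comment> \<open>The bound on \<open>Suc d\<close> guarantees that one more parameter is left to
    give up; for m = \<infinity> both sides are \<infinity>.\<close>
  have m: "m - enat d = eSuc (m - enat (Suc d))" and d: "enat d < m + 1"
    using Suc.prems by (cases m; auto simp: eSuc_enat one_enat_def)+
  have Z: "metrizable_space ?Z"
    using X by (simp add: metrizable_space_prod_topology metrizable_cube)
  have "fiberwise_DD (m - enat (Suc d)) (eSuc (enat d + n)) (eSuc (enat d + k)) (prod_topology unit_interval ?Z)"
    by (rule fiberwise_DD_unit_interval_prod[OF Z Suc.IH[OF d, unfolded m]])
  \<comment> \<open>The new interval becomes coordinate 0 of the larger cell.\<close>
  moreover have "homeomorphic_maps (prod_topology unit_interval ?Z) (prod_topology (cube (enat (Suc d))) X)
      (\<lambda>z. (case_nat (fst z) (fst (snd z)), snd (snd z))) (\<lambda>z. (fst z 0, (fst z \<circ> Suc, snd z)))"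
    unfolding homeomorphic_maps_def
  proof (intro conjI ballI)
    let ?A = "prod_topology unit_interval ?Z" and ?B = "prod_topology (cube (enat (Suc d))) X"
    have "continuous_map ?A ?A (\<lambda>z. z)" by simp
    note A = continuous_map_fst2[OF this] continuous_map_fst2[OF continuous_map_snd2[OF this]] continuous_map_snd2[OF continuous_map_snd2[OF this]]
    show "continuous_map ?A ?B (\<lambda>z. (case_nat (fst z) (fst (snd z)), snd (snd z)))"
      unfolding continuous_map_paired eSuc_enat[symmetric] using A by (intro conjI continuous_map_case_nat)
    show "continuous_map ?B ?A (\<lambda>z. (fst z 0, fst z \<circ> Suc, snd z))"
      unfolding continuous_map_paired eSuc_enat[symmetric]
      by (intro conjI continuous_map_hd[OF continuous_map_fst] continuous_map_tl[OF continuous_map_fst] continuous_map_snd)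
  qed (simp_all add: case_nat_hd_tl)
  ultimately have "fiberwise_DD (m - enat (Suc d)) (eSuc (enat d + n)) (eSuc (enat d + k)) (prod_topology (cube (enat (Suc d))) X)"
    by (rule fiberwise_DD_homeomorphic)
  then show ?case by (simp only: eSuc_enat[symmetric] iadd_Suc)
qed

theorem theorem11:
  fixes X :: "'a topology" and Y :: "'b topology"
    and k1 k2 k n1 n2 n m :: enat
  assumes "metrizable_space X" and "metrizable_space Y"
  shows "(fiberwise_DD m n k1 X \<and> fiberwise_DD m n k2 Y \<longrightarrow>
            fiberwise_DD m n (k1 + k2 + 1) (prod_topology X Y))
       \<and> (n = n1 + n2 + 1 \<and> k = k1 + k2 + 1 \<and>
            fiberwise_DD m n1 k1 X \<and> fiberwise_DD m n k2 Y \<and> fiberwise_DD m n2 k Y \<longrightarrow>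
            fiberwise_DD m n k (prod_topology X Y))
       \<and> (fiberwise_DD m n k X \<longrightarrow>
            (\<forall>d::nat. enat d < m + 1 \<longrightarrow>
               fiberwise_DD (m - enat d) (enat d + n) (enat d + k)
                 (prod_topology (cube (enat d)) X)))"
proof (intro conjI impI allI)
  show "fiberwise_DD m n (k1 + k2 + 1) (prod_topology X Y)"
    if "fiberwise_DD m n k1 X \<and> fiberwise_DD m n k2 Y"
    using that first_multiplication_formula[OF assms] by blast
  show "fiberwise_DD m n k (prod_topology X Y)"
    if "n = n1 + n2 + 1 \<and> k = k1 + k2 + 1 \<and>
            fiberwise_DD m n1 k1 X \<and> fiberwise_DD m n k2 Y \<and> fiberwise_DD m n2 k Y"
    using that by (elim conjE) (rule second_multiplication_formula[OF assms])
  show "fiberwise_DD (m - enat d) (enat d + n) (enat d + k) (prod_topology (cube (enat d)) X)"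
    if "fiberwise_DD m n k X" "enat d < m + 1" for d
    by (rule multiplication_by_cell[OF assms(1) that])
qed

end
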